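(* Let $0\le\kappa<1$ and $Q\in\mathbb R$, $Q\neq0$. Let $\Theta$ be a minimal $L$-system with one-dimensional input-output space $\mathbb C$ and $J=1$ whose impedance function $V_\Theta(z)$ belongs to the class $\mathfrak M^{-1,Q}_\kappa$. Let $\Theta_\alpha$, $\alpha\in[0,\pi)$, be a non-trivial ($\alpha\neq\pi/2$) unimodular transformation of $\Theta$. Then $V_{\Theta_\alpha}(z)\in\mathfrak M^{-1,-Q}_\kappa$ if and only if $$\tan\alpha=\frac{b}{2Q},\qquad\text{where}\quad b=Q^2+a^2-1\quad\text{and}\quad a=\frac{1+\kappa}{1-\kappa}.$$
   Context: $[X,Y]$ denotes the bounded linear operators from $X$ to $Y$; $\mathrm{Im}\,S=(S-S^* )/(2i)$, $\mathrm{Re}\,S=(S+S^* )/2$. **$L$-system with one-dimensional input-output.** Let $\dot A$ be a closed, densely defined symmetric operator with finite equal deficiency indices in a Hilbert space $\mathcal H$. Let $\mathcal H_+=\mathrm{Dom}(\dot A^* )$ with inner product $(f,g)_+=(f,g)+(\dot A^*f,\dot A^*g)$, and let $\mathcal H_+\subset\mathcal H\subset\mathcal H_-$ be the corresponding rigged Hilbert space ($\mathcal H_-$ is dual to $\mathcal H_+$ with respect to the pairing extending the inner product of $\mathcal H$), with the conjugate of $\mathcal H_\pm$ identified with $\mathcal H_\mp$. A quasi-self-adjoint extension of $\dot A$ is a non-symmetric operator $T$ with $\dot A\subset T\subset\dot A^*$; it belongs to $\Lambda(\dot A)$ if $\rho(T)\ne\emptyset$ and $\mathrm{Dom}(\dot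 A)=\mathrm{Dom}(T)\cap\mathrm{Dom}(T^* )$. An operator $\mathbb A\in[\mathcal H_+,\mathcal H_-]$ is a $( * )$-extension of $T$ if $\mathbb A\supset T\supset\dot A$, $\mathbb A^*\supset T^*\supset\dot A$, and the quasi-kernel $\hat A$ of $\mathrm{Re}\,\mathbb A$, i.e. the restriction of $\mathrm{Re}\,\mathbb A$ to $\{f\in\mathcal H_+:\mathrm{Re}\,\mathbb A f\in\mathcal H\}$, is self-adjoint in $\mathcal H$. An $L$-system with $E=\mathbb C$, $J=1$, $$\Theta=\begin{pmatrix}\mathbb A&K&1\\ \mathcal H_+\subset\mathcal H\subset\mathcal H_-&&\mathbb C\end{pmatrix},$$ consists of a $( * )$-extension $\mathbb A$ of some $T\in\Lambda(\dot A)$ (the main operator) and $K\in[\mathbb C,\mathcal H_-]$ with $\mathrm{Im}\,\mathbb A=KK^*$ and $\mathrm{Ran}(K)=\mathrm{Ran}(\mathrm{Im}\,\mathbb A)$. It is minimal if $\dot A$ is prime, i.e. there is no non-trivial reducing subspace of $\mathcal H$ on which $\dot A$ induces a self-adjoint operator. Its transfer function is $W_\Theta(z)=1-2iK^*(\mathbb A-zI)^{-1}K$, $z\in\rho(T)$, and its impedance function is $V_\Theta(z)=K^*(\mathrm{Re}\,\mathbb A-zI)^{-1}K$, $z\in\rho(\hat A)$ (both are known to be well defined, and $V_\Theta=i(W_\Theta-1)/(W_\Theta+1)$ for $\mathrm{Im}\,z\ne0$, $z\in\rho(T)$). **Unimodular transformation.** For $\alpha\in[0,\pi)$, an $L$-system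 with $E=\mathbb C$, $J=1$, $$\Theta_\alpha=\begin{pmatrix}\mathbb A_\alpha&K_\alpha&1\\ \mathcal H_+^{(\alpha)}\subset\mathcal H^{(\alpha)}\subset\mathcal H_-^{(\alpha)}&&\mathbb C\end{pmatrix}$$ (that is, $\mathcal H_+^{(\alpha)}\subset\mathcal H^{(\alpha)}\subset\mathcal H_-^{(\alpha)}$ is the rigged Hilbert space with $\mathcal H_+^{(\alpha)}=\mathrm{Dom}(\dot A_\alpha^* )$ for a closed, densely defined symmetric operator $\dot A_\alpha$ with finite equal deficiency indices in $\mathcal H^{(\alpha)}$, $\mathbb A_\alpha$ is a $( * )$-extension of some $T_\alpha\in\Lambda(\dot A_\alpha)$, and $K_\alpha\in[\mathbb C,\mathcal H_-^{(\alpha)}]$ with $\mathrm{Im}\,\mathbb A_\alpha=K_\alpha K_\alpha^*$ and $\mathrm{Ran}(K_\alpha)=\mathrm{Ran}(\mathrm{Im}\,\mathbb A_\alpha)$), with transfer function $W_{\Theta_\alpha}(z)=1-2iK_\alpha^*(\mathbb A_\alpha-zI)^{-1}K_\alpha$ and impedance function $V_{\Theta_\alpha}(z)=K_\alpha^*(\mathrm{Re}\,\mathbb A_\alpha-zI)^{-1}K_\alpha$, is a unimodular transformation of $\Theta$ if $W_{\Theta_\alpha}(z)=W_\Theta(z)\cdot(-e^{2i\alpha})$. The case $\alpha=\pi/2$ is the trivial one. **Class $\mathfrak M^{-1,Q}_\kappa$** ($Q\in\mathbb R$, $0\le\kappa<1$): scalar Herglotz–Nevanlinna functions $V$ (analytic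 maps of $\mathbb C_+$ into itself) admitting the representation $$V(z)=Q+\int_{\mathbb R}\left(\frac1{\lambda-z}-\frac{\lambda}{1+\lambda^2}\right)d\mu(\lambda),$$ where $\mu$ is an infinite Borel measure with $\int_{\mathbb R}\frac{d\mu(\lambda)}{1+\lambda^2}=\frac{1+\kappa}{1-\kappa}$. *)

theory Defs
  imports "HOL-Analysis.Analysis"
begin

text \<open>
  A complex Hilbert space is a complete real inner product space together with a compatible complex
  structure; \<open>cinner\<close> is linear in its \<^emph>\<open>first\<close> argument, and the norm and topology
  are those of its real part.
\<close>

class complex_hilbert = real_inner + banach +
  fixes scaleC :: "complex \<Rightarrow> 'a \<Rightarrow> 'a"
    and cinner :: "'a \<Rightarrow> 'a \<Rightarrow> complex"
  assumes scaleC_add_right: "scaleC c (x + y) = scaleC c x + scaleC c y"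
    and scaleC_add_left: "scaleC (c + d) x = scaleC c x + scaleC d x"
    and scaleC_scaleC: "scaleC c (scaleC d x) = scaleC (c * d) x"
    and scaleR_scaleC: "scaleR r x = scaleC (complex_of_real r) x"
    and cinner_add_left: "cinner (x + y) z = cinner x z + cinner y z"
    and cinner_scaleC_left: "cinner (scaleC c x) y = c * cinner x y"
    and cinner_commute: "cinner y x = cnj (cinner x y)"
    and inner_cinner: "inner x y = Re (cinner x y)"

global_interpretation cvec: vector_space "scaleC :: complex \<Rightarrow> 'a \<Rightarrow> 'a::complex_hilbert"
proof
  show "scaleC 1 x = x" for x :: 'a
    using scaleR_scaleC[of 1 x] by simp
qed (simp_all add: scaleC_add_right scaleC_add_left scaleC_scaleC)


subsection \<open>Unbounded operators\<close>

text \<open>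
  An operator is represented by its graph, so \<open>Domain T\<close> is its domain, \<open>S \<subseteq> T\<close> says that \<open>T\<close>
  extends \<open>S\<close>, and \<open>closed T\<close> (in the product topology) says that \<open>T\<close> is a closed operator.
\<close>

type_synonym 'a operator = "('a \<times> 'a) set"

definition linear_operator :: "'a::complex_hilbert operator \<Rightarrow> bool" where
  "linear_operator T \<longleftrightarrow> single_valued T \<and> (0, 0) \<in> T \<and>
     (\<forall>f g f' g'. (f, g) \<in> T \<longrightarrow> (f', g') \<in> T \<longrightarrow> (f + f', g + g') \<in> T) \<and>
     (\<forall>c f g. (f, g) \<in> T \<longrightarrow> (scaleC c f, scaleC c g) \<in> T)"

definition op_app :: "'a operator \<Rightarrow> 'a \<Rightarrow> 'a" where
  "op_app T f = (THE g. (f, g) \<in> T)"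

definition adjoint_in :: "'a::complex_hilbert set \<Rightarrow> 'a operator \<Rightarrow> 'a operator" where
  "adjoint_in M T = {(g, h). g \<in> M \<and> h \<in> M \<and> (\<forall>(f, f') \<in> T. cinner f' g = cinner f h)}"

abbreviation adj :: "'a::complex_hilbert operator \<Rightarrow> 'a operator" where
  "adj T \<equiv> adjoint_in UNIV T"

definition selfadjoint_in :: "'a::complex_hilbert set \<Rightarrow> 'a operator \<Rightarrow> bool" where
  "selfadjoint_in M T \<longleftrightarrow>
     linear_operator T \<and> T \<subseteq> M \<times> M \<and> M \<subseteq> closure (Domain T) \<and> adjoint_in M T = T"

definition symmetric_operator :: "'a::complex_hilbert operator \<Rightarrow> bool" where
  "symmetric_operator T \<longleftrightarrow> T \<subseteq> adj T"

definition resolvent_set :: "'a::complex_hilbert operator \<Rightarrow> complex set" where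
  "resolvent_set T = {z. (\<forall>h. \<exists>!f. (f, h + scaleC z f) \<in> T) \<and>
     (\<exists>C. \<forall>(f, g) \<in> T. norm f \<le> C * norm (g - scaleC z f))}"

definition defect_space :: "'a::complex_hilbert operator \<Rightarrow> complex \<Rightarrow> 'a set" where
  "defect_space A z = {f. (f, scaleC z f) \<in> adj A}"

text \<open>
  \<open>cvec.dim\<close> is only meaningful on finite-dimensional subspaces, hence the explicit
  finiteness conditions.
\<close>

definition finite_equal_deficiency_indices :: "'a::complex_hilbert operator \<Rightarrow> bool" where
  "finite_equal_deficiency_indices A \<longleftrightarrow>
     (\<exists>B. finite B \<and> defect_space A \<i> \<subseteq> cvec.span B) \<and>
     (\<exists>B. finite B \<and> defect_space A (- \<i>) \<subseteq> cvec.span B) \<and>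
     cvec.dim (defect_space A \<i>) = cvec.dim (defect_space A (- \<i>))"

definition admissible_symmetric :: "'a::complex_hilbert operator \<Rightarrow> bool" where
  "admissible_symmetric A \<longleftrightarrow> linear_operator A \<and> closed A \<and> closure (Domain A) = UNIV \<and>
     symmetric_operator A \<and> finite_equal_deficiency_indices A"

definition orth_compl :: "'a::complex_hilbert set \<Rightarrow> 'a set" where
  "orth_compl M = {x. \<forall>y\<in>M. cinner x y = 0}"

text \<open>
  A closed subspace reduces \<open>A\<close> if \<open>A\<close> is the direct sum of its parts in the subspace and in the
  orthogonal complement.
\<close>

definition reducing_subspace :: "'a::complex_hilbert set \<Rightarrow> 'a operator \<Rightarrow> bool" where
  "reducing_subspace M A \<longleftrightarrow> cvec.subspace M \<and> closed M \<and>
     (\<forall>(f, g) \<in> A. \<exists>f1 g1 f2 g2. (f1, g1) \<in> A \<inter> M \<times> M \<and>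
        (f2, g2) \<in> A \<inter> orth_compl M \<times> orth_compl M \<and> f = f1 + f2 \<and> g = g1 + g2)"

definition prime_operator :: "'a::complex_hilbert operator \<Rightarrow> bool" where
  "prime_operator A \<longleftrightarrow>
     \<not> (\<exists>M. reducing_subspace M A \<and> M \<noteq> {0} \<and> selfadjoint_in M (A \<inter> M \<times> M))"

definition quasi_selfadjoint_extension ::
  "'a::complex_hilbert operator \<Rightarrow> 'a operator \<Rightarrow> bool" where
  "quasi_selfadjoint_extension A T \<longleftrightarrow>
     linear_operator T \<and> \<not> symmetric_operator T \<and> A \<subseteq> T \<and> T \<subseteq> adj A"

definition class_Lambda :: "'a::complex_hilbert operator \<Rightarrow> 'a operator set" where
  "class_Lambda A = {T. quasi_selfadjoint_extension A T \<and> resolvent_set T \<noteq> {} \<and>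
     Domain A = Domain T \<inter> Domain (adj T)}"


subsection \<open>The rigged Hilbert space of a symmetric operator\<close>

definition plus_space :: "'a::complex_hilbert operator \<Rightarrow> 'a set" where
  "plus_space A = Domain (adj A)"

definition plus_inner :: "'a::complex_hilbert operator \<Rightarrow> 'a \<Rightarrow> 'a \<Rightarrow> complex" where
  "plus_inner A f g = cinner f g + cinner (op_app (adj A) f) (op_app (adj A) g)"

definition plus_norm :: "'a::complex_hilbert operator \<Rightarrow> 'a \<Rightarrow> real" where
  "plus_norm A f = sqrt (Re (plus_inner A f f))"

text \<open>
  The negative space consists of the bounded antilinear functionals on the positive space. The
  pairing of \<open>\<phi>\<close> with \<open>g\<close> is \<open>\<phi> g\<close>, linear in \<open>\<phi>\<close> and antilinear in \<open>g\<close>; via \<open>embed_minus\<close>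
  it extends the inner product. Functionals are set to \<open>0\<close> outside the positive space, so that
  equality of functionals is equality of functions.
\<close>

definition minus_space :: "'a::complex_hilbert operator \<Rightarrow> ('a \<Rightarrow> complex) set" where
  "minus_space A = {\<phi>.
     (\<forall>g\<in>plus_space A. \<forall>h\<in>plus_space A. \<phi> (g + h) = \<phi> g + \<phi> h) \<and>
     (\<forall>c. \<forall>g\<in>plus_space A. \<phi> (scaleC c g) = cnj c * \<phi> g) \<and>
     (\<exists>C. \<forall>g\<in>plus_space A. cmod (\<phi> g) \<le> C * plus_norm A g) \<and>
     (\<forall>g. g \<notin> plus_space A \<longrightarrow> \<phi> g = 0)}"

definition embed_minus :: "'a::complex_hilbert operator \<Rightarrow> 'a \<Rightarrow> 'a \<Rightarrow> complex" where
  "embed_minus A f = (\<lambda>g. if g \<in> plus_space A then cinner f g else 0)"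

text \<open>
  Bounded operators from the positive to the negative space; values off the positive space are
  irrelevant. The last conjunct is \<open>\<parallel>S f\<parallel>\<^sub>- \<le> C \<parallel>f\<parallel>\<^sub>+\<close> with the dual norm written out.
\<close>

definition bounded_plus_minus ::
  "'a::complex_hilbert operator \<Rightarrow> ('a \<Rightarrow> 'a \<Rightarrow> complex) \<Rightarrow> bool" where
  "bounded_plus_minus A S \<longleftrightarrow>
     (\<forall>f\<in>plus_space A. S f \<in> minus_space A) \<and>
     (\<forall>f\<in>plus_space A. \<forall>g\<in>plus_space A. S (f + g) = (\<lambda>h. S f h + S g h)) \<and>
     (\<forall>c. \<forall>f\<in>plus_space A. S (scaleC c f) = (\<lambda>h. c * S f h)) \<and>
     (\<exists>C. \<forall>f\<in>plus_space A. \<forall>g\<in>plus_space A. cmod (S f g) \<le> C * plus_norm A f * plus_norm A g)"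

text \<open>The adjoint is given by \<open>(S f, g) = (f, S\<^sup>* g)\<close>, that is, \<open>S\<^sup>* g f = cnj (S f g)\<close>.\<close>

definition rig_adj ::
  "'a::complex_hilbert operator \<Rightarrow> ('a \<Rightarrow> 'a \<Rightarrow> complex) \<Rightarrow> 'a \<Rightarrow> 'a \<Rightarrow> complex" where
  "rig_adj A S = (\<lambda>g f. if f \<in> plus_space A then cnj (S f g) else 0)"

definition rig_Re ::
  "'a::complex_hilbert operator \<Rightarrow> ('a \<Rightarrow> 'a \<Rightarrow> complex) \<Rightarrow> 'a \<Rightarrow> 'a \<Rightarrow> complex" where
  "rig_Re A S = (\<lambda>f g. (S f g + rig_adj A S f g) / 2)"

definition rig_Im ::
  "'a::complex_hilbert operator \<Rightarrow> ('a \<Rightarrow> 'a \<Rightarrow> complex) \<Rightarrow> 'a \<Rightarrow> 'a \<Rightarrow> complex" where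
  "rig_Im A S = (\<lambda>f g. (S f g - rig_adj A S f g) / (2 * \<i>))"

definition rig_extends ::
  "'a::complex_hilbert operator \<Rightarrow> ('a \<Rightarrow> 'a \<Rightarrow> complex) \<Rightarrow> 'a operator \<Rightarrow> bool" where
  "rig_extends A S T \<longleftrightarrow> (\<forall>(f, g) \<in> T. f \<in> plus_space A \<and> S f = embed_minus A g)"

definition quasi_kernel ::
  "'a::complex_hilbert operator \<Rightarrow> ('a \<Rightarrow> 'a \<Rightarrow> complex) \<Rightarrow> 'a operator" where
  "quasi_kernel A S = {(f, g). f \<in> plus_space A \<and> S f = embed_minus A g}"

definition star_extension ::
  "'a::complex_hilbert operator \<Rightarrow> 'a operator \<Rightarrow> ('a \<Rightarrow> 'a \<Rightarrow> complex) \<Rightarrow> bool" where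
  "star_extension A T S \<longleftrightarrow> bounded_plus_minus A S \<and>
     rig_extends A S T \<and> A \<subseteq> T \<and>
     rig_extends A (rig_adj A S) (adj T) \<and> A \<subseteq> adj T \<and>
     selfadjoint_in UNIV (quasi_kernel A (rig_Re A S))"

definition rig_resolvent ::
  "'a::complex_hilbert operator \<Rightarrow> ('a \<Rightarrow> 'a \<Rightarrow> complex) \<Rightarrow> complex \<Rightarrow> ('a \<Rightarrow> complex) \<Rightarrow> 'a" where
  "rig_resolvent A S z = inv_into (plus_space A) (\<lambda>f g. S f g - z * embed_minus A f g)"


subsection \<open>L-systems with one-dimensional input-output\<close>

definition bounded_channel ::
  "'a::complex_hilbert operator \<Rightarrow> (complex \<Rightarrow> 'a \<Rightarrow> complex) \<Rightarrow> bool" where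
  "bounded_channel A K \<longleftrightarrow>
     (\<forall>c. K c \<in> minus_space A) \<and>
     (\<forall>c d. K (c + d) = (\<lambda>g. K c g + K d g)) \<and>
     (\<forall>c d. K (c * d) = (\<lambda>g. c * K d g)) \<and>
     (\<exists>C. \<forall>c. \<forall>g\<in>plus_space A. cmod (K c g) \<le> C * cmod c * plus_norm A g)"

text \<open>The adjoint channel is determined by \<open>(K c, g) = c * cnj (K\<^sup>* g)\<close>; take \<open>c = 1\<close>.\<close>

definition channel_adj :: "(complex \<Rightarrow> 'a \<Rightarrow> complex) \<Rightarrow> 'a \<Rightarrow> complex" where
  "channel_adj K g = cnj (K 1 g)"

record 'a lsys =
  sym_op :: "'a operator"
  main_op :: "'a operator"
  state_op :: "'a \<Rightarrow> 'a \<Rightarrow> complex"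
  channel :: "complex \<Rightarrow> 'a \<Rightarrow> complex"

definition L_system :: "'a::complex_hilbert lsys \<Rightarrow> bool" where
  "L_system \<Theta> \<longleftrightarrow>
     (let A = sym_op \<Theta>; T = main_op \<Theta>; S = state_op \<Theta>; K = channel \<Theta> in
        admissible_symmetric A \<and> T \<in> class_Lambda A \<and> star_extension A T S \<and>
        bounded_channel A K \<and>
        (\<forall>f\<in>plus_space A. rig_Im A S f = K (channel_adj K f)) \<and>
        range K = rig_Im A S ` plus_space A)"

definition minimal_L_system :: "'a::complex_hilbert lsys \<Rightarrow> bool" where
  "minimal_L_system \<Theta> \<longleftrightarrow> L_system \<Theta> \<and> prime_operator (sym_op \<Theta>)"

text \<open>
  Meaningful for \<open>z\<close> in the resolvent set of the main operator, respectively of the quasi-kernel of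
  the real part (which contains all non-real \<open>z\<close>). Operators on \<open>\<complex>\<close> are identified with scalars.
\<close>

definition transfer_function :: "'a::complex_hilbert lsys \<Rightarrow> complex \<Rightarrow> complex" where
  "transfer_function \<Theta> z = 1 - 2 * \<i> *
     channel_adj (channel \<Theta>) (rig_resolvent (sym_op \<Theta>) (state_op \<Theta>) z (channel \<Theta> 1))"

definition impedance_function :: "'a::complex_hilbert lsys \<Rightarrow> complex \<Rightarrow> complex" where
  "impedance_function \<Theta> z =
     channel_adj (channel \<Theta>)
       (rig_resolvent (sym_op \<Theta>) (rig_Re (sym_op \<Theta>) (state_op \<Theta>)) z (channel \<Theta> 1))"

text \<open>The two systems may live in different Hilbert spaces.\<close>

definition unimodular_transformation ::
  "real \<Rightarrow> 'b::complex_hilbert lsys \<Rightarrow> 'a::complex_hilbert lsys \<Rightarrow> bool" where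
  "unimodular_transformation \<alpha> \<Theta>' \<Theta> \<longleftrightarrow>
     L_system \<Theta> \<and> L_system \<Theta>' \<and> 0 \<le> \<alpha> \<and> \<alpha> < pi \<and>
     (\<forall>z \<in> resolvent_set (main_op \<Theta>) \<inter> resolvent_set (main_op \<Theta>').
        transfer_function \<Theta>' z = transfer_function \<Theta> z * (- exp (2 * \<i> * complex_of_real \<alpha>)))"


subsection \<open>Herglotz--Nevanlinna functions\<close>

definition herglotz_nevanlinna :: "(complex \<Rightarrow> complex) \<Rightarrow> bool" where
  "herglotz_nevanlinna V \<longleftrightarrow>
     V holomorphic_on {z. 0 < Im z} \<and> V ` {z. 0 < Im z} \<subseteq> {z. 0 < Im z}"

text \<open>Membership only concerns the values of \<open>V\<close> on the open upper half-plane.\<close>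

definition class_M_inv :: "real \<Rightarrow> real \<Rightarrow> (complex \<Rightarrow> complex) set" where
  "class_M_inv \<kappa> Q = {V. herglotz_nevanlinna V \<and>
     (\<exists>\<mu> :: real measure. sets \<mu> = sets borel \<and> emeasure \<mu> UNIV = \<infinity> \<and>
        has_bochner_integral \<mu> (\<lambda>t. 1 / (1 + t\<^sup>2)) ((1 + \<kappa>) / (1 - \<kappa>)) \<and>
        (\<forall>z. 0 < Im z \<longrightarrow>
           V z = complex_of_real Q +
             (LINT t|\<mu>. (1 / (complex_of_real t - z) - complex_of_real (t / (1 + t\<^sup>2))))))}"

end

theory Submission
  imports Defs "HOL-Complex_Analysis.Complex_Analysis" "HOL-Probability.Probability"
begin

text \<open>
  Put \<open>\<tau> = tan \<alpha>\<close> and write \<open>V\<close> and \<open>U\<close> for the impedance functions of \<open>\<Theta>\<close> and \<open>\<Theta>\<^sub>\<alpha>\<close>. In terms of the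
  impedance functions the relation between the transfer functions reads
  \<open>U = (1 + \<tau> V) / (\<tau> - V)\<close>, and the theorem is a statement about this fractional linear map.

  A member of the class with parameters \<open>\<kappa>, Q\<close> has the value \<open>Q + i a\<close> at \<open>i\<close>. Hence
  \<open>U\<close> can belong to the class with parameters \<open>\<kappa>, - Q\<close> only if the map sends \<open>Q + i a\<close> to
  \<open>- Q + i a\<close>; comparing real and imaginary parts, this means \<open>2 \<tau> Q = Q\<^sup>2 + a\<^sup>2 - 1\<close>. Conversely, the
  value at \<open>i\<close> is the only obstruction (\<open>class_M_inv_rotation\<close>): \<open>U\<close> is a Herglotz--Nevanlinna function,
  and it has a representation without a linear term and with an infinite measure because \<open>V\<close> has one.
  Both properties are read off the imaginary axis: \<open>y Im V (i y)\<close> tends to infinity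
  because the measure of \<open>V\<close> is infinite (\<open>y_Im_unbounded\<close>), and \<open>V (i y) / y\<close> tends to \<open>0\<close>
  (\<open>no_linear_growth\<close>).

  Two ingredients carry this out. The first is the formula for \<open>U\<close>
  (\<open>impedance_of_unimodular_transformation\<close>). With \<open>R\<close> the real part of the state operator, the
  vector \<open>(R - z)\<^sup>-\<^sup>1 K 1\<close> exists for nonreal \<open>z\<close>, and it yields
  \<open>W = (1 - i V) / (1 + i V)\<close>. The transfer functions are only known to be related at regular points of
  the main operators. These are dissipative, so the lower half-plane consists of regular points
  (\<open>lower_half_plane_in_resolvent_set\<close>), whereas the upper one may contain eigenvalues. The formula is
  therefore derived in the lower half-plane and transferred by the symmetry \<open>V (cnj z) = cnj (V z)\<close>.

  The second is Herglotz's representation theorem. On the disc it follows from Cauchy's formula on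
  circles of radius \<open>r < 1\<close> and weak compactness as \<open>r\<close> tends to \<open>1\<close>
  (\<open>herglotz_representation_disc\<close>); the Cayley transform carries it to the half-plane, where a linear term
  is the contribution of an atom at infinity (\<open>herglotz_representation_without_linear_term\<close>).
\<close>

section \<open>Complex Hilbert spaces\<close>

lemma cinner_add_right: "cinner x (y + z) = cinner x y + cinner x z"
  for x y z :: "'a::complex_hilbert"
proof -
  have "cinner x (y + z) = cnj (cinner (y + z) x)" by (rule cinner_commute)
  also have "\<dots> = cnj (cinner y x) + cnj (cinner z x)" by (simp add: cinner_add_left)
  finally show ?thesis by (simp add: cinner_commute[symmetric])
qed

lemma cinner_scaleC_right: "cinner x (scaleC c y) = cnj c * cinner x y"
  for x y :: "'a::complex_hilbert"
proof -
  have "cinner x (scaleC c y) = cnj (cinner (scaleC c y) x)" by (rule cinner_commute)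
  also have "\<dots> = cnj c * cnj (cinner y x)" by (simp add: cinner_scaleC_left)
  finally show ?thesis by (simp add: cinner_commute[symmetric])
qed

lemma scaleC_minus_one: "scaleC (- 1) x = - x" for x :: "'a::complex_hilbert"
  using scaleR_scaleC[of "-1" x] by simp

lemma cinner_minus_left: "cinner (- x) y = - cinner x y" for x y :: "'a::complex_hilbert"
  using cinner_scaleC_left[of "-1" x y] by (simp add: scaleC_minus_one)

lemma cinner_minus_right: "cinner x (- y) = - cinner x y" for x y :: "'a::complex_hilbert"
  using cinner_scaleC_right[of x "-1" y] by (simp add: scaleC_minus_one)

lemma cinner_diff_left: "cinner (x - y) z = cinner x z - cinner y z"
  for x y z :: "'a::complex_hilbert"
  using cinner_add_left[of x "- y" z] by (simp add: cinner_minus_left)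

lemma cinner_diff_right: "cinner x (y - z) = cinner x y - cinner x z"
  for x y z :: "'a::complex_hilbert"
  using cinner_add_right[of x y "- z"] by (simp add: cinner_minus_right)

lemmas cinner_simps = cinner_add_left cinner_add_right cinner_diff_left cinner_diff_right
  cinner_minus_left cinner_minus_right cinner_scaleC_left cinner_scaleC_right

lemma cinner_self: "cinner x x = complex_of_real ((norm x)\<^sup>2)" for x :: "'a::complex_hilbert"
proof (rule complex_eqI)
  show "Re (cinner x x) = Re (complex_of_real ((norm x)\<^sup>2))"
    by (simp add: inner_cinner[symmetric] power2_norm_eq_inner)
  show "Im (cinner x x) = Im (complex_of_real ((norm x)\<^sup>2))"
    using cinner_commute[of x x] by (simp add: complex_eq_iff)
qed

lemma norm_scaleC: "norm (scaleC c x) = cmod c * norm x" for x :: "'a::complex_hilbert"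
proof -
  have "complex_of_real ((norm (scaleC c x))\<^sup>2) = c * cnj c * cinner x x"
    using cinner_self[of "scaleC c x"] by (simp add: cinner_scaleC_left cinner_scaleC_right mult_ac)
  also have "\<dots> = complex_of_real ((cmod c * norm x)\<^sup>2)"
    using complex_norm_square[of c] by (simp add: cinner_self power_mult_distrib)
  finally have "complex_of_real ((norm (scaleC c x))\<^sup>2) = complex_of_real ((cmod c * norm x)\<^sup>2)" .
  then have "(norm (scaleC c x))\<^sup>2 = (cmod c * norm x)\<^sup>2" by (simp only: of_real_eq_iff)
  then show ?thesis by (simp add: power2_eq_iff_nonneg)
qed

lemma bounded_linear_scaleC: "bounded_linear (scaleC c :: 'a::complex_hilbert \<Rightarrow> 'a)"
proof (rule bounded_linear_intro[where K = "cmod c"])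
  show "scaleC c (r *\<^sub>R x) = r *\<^sub>R scaleC c x" for r and x :: 'a
    by (simp add: scaleR_scaleC scaleC_scaleC mult.commute)
qed (simp_all add: scaleC_add_right norm_scaleC mult.commute)

lemma cinner_eq_inner: "cinner x y = Complex (inner x y) (inner x (scaleC \<i> y))"
  for x y :: "'a::complex_hilbert"
  by (rule complex_eqI) (simp_all add: inner_cinner cinner_scaleC_right)

lemma tendsto_cinner:
  fixes f g :: "nat \<Rightarrow> 'a::complex_hilbert"
  assumes "f \<longlonglongrightarrow> x" and "g \<longlonglongrightarrow> y"
  shows "(\<lambda>n. cinner (f n) (g n)) \<longlonglongrightarrow> cinner x y"
  unfolding cinner_eq_inner
  by (intro tendsto_Complex tendsto_inner assms bounded_linear.tendsto[OF bounded_linear_scaleC])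

lemma cauchy_schwarz_cinner: "cmod (cinner x y) \<le> norm x * norm y" for x y :: "'a::complex_hilbert"
proof (cases "cinner x y = 0")
  case False
  define c where "c = cnj (cinner x y) / cmod (cinner x y)"
  have c: "cmod c = 1" using False by (simp add: c_def norm_divide)
  have "cnj (cinner x y) * cinner x y = complex_of_real (cmod (cinner x y)) * cmod (cinner x y)"
    using complex_norm_square[of "cinner x y"] by (simp add: power2_eq_square mult.commute)
  then have "complex_of_real (cmod (cinner x y)) = cinner (scaleC c x) y"
    using False by (simp add: c_def cinner_scaleC_left)
  then have "cmod (cinner x y) = inner (scaleC c x) y"
    unfolding inner_cinner by (metis Re_complex_of_real)
  also have "\<dots> \<le> norm (scaleC c x) * norm y" by (rule norm_cauchy_schwarz)
  finally show ?thesis by (simp add: norm_scaleC c)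
qed simp

text \<open>
  A minimizing sequence for the distance from \<open>x\<close> to \<open>M\<close> is Cauchy by the parallelogram law; the
  difference between \<open>x\<close> and its limit, the nearest point of \<open>M\<close>, is orthogonal to \<open>M\<close>.
\<close>

lemma closed_subspace_orthogonal_vector:
  fixes M :: "'a::{real_inner, banach} set"
  assumes M: "subspace M" "closed M" and x: "x \<notin> M"
  obtains u where "u \<noteq> 0" and "\<And>m. m \<in> M \<Longrightarrow> inner m u = 0"
proof -
  define d where "d = infdist x M"
  have ne: "M \<noteq> {}" using subspace_0[OF M(1)] by auto
  have d0: "0 \<le> d" by (simp add: d_def infdist_nonneg)
  have dle: "d \<le> norm (x - m)" if "m \<in> M" for m
    using infdist_le[OF that, of x] by (simp add: d_def dist_norm)
  have "\<exists>m\<in>M. norm (x - m) < d + 1 / real (Suc n)" for n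
  proof -
    have "infdist x M < d + 1 / real (Suc n)" by (simp add: d_def)
    then have "\<exists>m\<in>M. dist x m < d + 1 / real (Suc n)"
      using ne cINF_less_iff[OF ne bdd_below_image_dist, of x] by (simp add: infdist_def)
    then show ?thesis by (simp add: dist_norm)
  qed
  then obtain m where m: "\<And>n. m n \<in> M" "\<And>n. norm (x - m n) < d + 1 / real (Suc n)" by metis
  have lim: "(\<lambda>n. (d + 1 / real (Suc n))\<^sup>2) \<longlonglongrightarrow> d\<^sup>2"
    using tendsto_power[OF tendsto_add[OF tendsto_const LIMSEQ_inverse_real_of_nat], of d 2]
    by (simp add: divide_inverse)
  have par: "(norm (m j - m k))\<^sup>2 \<le> 2 * ((d + 1 / real (Suc j))\<^sup>2 - d\<^sup>2) + 2 * ((d + 1 / real (Suc k))\<^sup>2 - d\<^sup>2)"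
    for j k
  proof -
    have "(1/2) *\<^sub>R (m j + m k) \<in> M"
      by (intro subspace_mul[OF M(1)] subspace_add[OF M(1)] m)
    then have "d\<^sup>2 \<le> (norm (x - (1/2) *\<^sub>R (m j + m k)))\<^sup>2"
      by (intro power_mono dle d0)
    moreover have "(norm (m j - m k))\<^sup>2 = 2 * (norm (x - m j))\<^sup>2 + 2 * (norm (x - m k))\<^sup>2
        - 4 * (norm (x - (1/2) *\<^sub>R (m j + m k)))\<^sup>2"
      unfolding power2_norm_eq_inner by (simp add: inner_simps inner_commute algebra_simps)
    moreover have "(norm (x - m i))\<^sup>2 \<le> (d + 1 / real (Suc i))\<^sup>2" for i
      using m(2)[of i] by (intro power_mono) auto
    note this[of j] this[of k]
    ultimately show ?thesis by argo
  qed
  have "Cauchy m"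
  proof (rule metric_CauchyI)
    fix e :: real assume e: "0 < e"
    have "eventually (\<lambda>n. (d + 1 / real (Suc n))\<^sup>2 < d\<^sup>2 + e\<^sup>2 / 4) sequentially"
      using e by (intro order_tendstoD(2)[OF lim]) simp
    then obtain N where N: "\<And>n. n \<ge> N \<Longrightarrow> (d + 1 / real (Suc n))\<^sup>2 < d\<^sup>2 + e\<^sup>2 / 4"
      by (auto simp: eventually_sequentially)
    have "dist (m j) (m k) < e" if "j \<ge> N" "k \<ge> N" for j k
    proof -
      have "(norm (m j - m k))\<^sup>2 < e\<^sup>2"
        using par[of j k] N[OF that(1)] N[OF that(2)] by argo
      then show ?thesis using e by (simp add: dist_norm power_less_imp_less_base)
    qed
    then show "\<exists>N. \<forall>j\<ge>N. \<forall>k\<ge>N. dist (m j) (m k) < e" by blast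
  qed
  then obtain p where p: "m \<longlonglongrightarrow> p" using Cauchy_convergent convergent_def by blast
  have pM: "p \<in> M" using closed_sequentially[OF M(2) m(1) p] .
  have "(\<lambda>n. (norm (x - m n))\<^sup>2) \<longlonglongrightarrow> (norm (x - p))\<^sup>2" by (intro tendsto_intros p)
  moreover have "(norm (x - m n))\<^sup>2 \<le> (d + 1 / real (Suc n))\<^sup>2" for n
    using m(2)[of n] by (intro power_mono) auto
  ultimately have pd: "(norm (x - p))\<^sup>2 \<le> d\<^sup>2" using LIMSEQ_le[OF _ lim] by blast
  show thesis
  proof
    show "x - p \<noteq> 0" using pM x by auto
    fix u assume u: "u \<in> M"
    show "inner u (x - p) = 0"
    proof (cases "u = 0")
      case False
      \<comment> \<open>\<open>s u\<close> is the component of \<open>x - p\<close> along \<open>u\<close>; moving \<open>p\<close> by it would bring it nearer to \<open>x\<close>.\<close>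
      define s where "s = inner u (x - p) / (inner u u)"
      have uu: "inner u u > 0" using False by simp
      have "d\<^sup>2 \<le> (norm (x - (p + s *\<^sub>R u)))\<^sup>2"
        by (intro power_mono dle d0 subspace_add[OF M(1)] subspace_mul[OF M(1)] pM u)
      also have "\<dots> = (norm (x - p))\<^sup>2 - 2 * s * inner u (x - p) + s * (s * inner u u)"
        unfolding power2_norm_eq_inner by (simp add: inner_simps inner_commute algebra_simps)
      also have "s * inner u u = inner u (x - p)" using uu by (simp add: s_def)
      finally have "s * inner u (x - p) \<le> 0" using pd by argo
      then have "(inner u (x - p))\<^sup>2 \<le> 0"
        using uu by (simp add: s_def divide_le_0_iff power2_eq_square)
      then show ?thesis by simp
    qed simp
  qed
qed

section \<open>Resolvents of unbounded operators\<close>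

lemma linear_operatorD:
  assumes "linear_operator T"
  shows "(0, 0) \<in> T"
    and "(f, g) \<in> T \<Longrightarrow> (f', g') \<in> T \<Longrightarrow> (f + f', g + g') \<in> T"
    and "(f, g) \<in> T \<Longrightarrow> (scaleC c f, scaleC c g) \<in> T"
    and "(f, g) \<in> T \<Longrightarrow> (f', g') \<in> T \<Longrightarrow> (f - f', g - g') \<in> T"
proof -
  note L = assms[unfolded linear_operator_def]
  show "(0, 0) \<in> T"
    and add: "\<And>f g f' g'. (f, g) \<in> T \<Longrightarrow> (f', g') \<in> T \<Longrightarrow> (f + f', g + g') \<in> T"
    and sc: "\<And>f g c. (f, g) \<in> T \<Longrightarrow> (scaleC c f, scaleC c g) \<in> T"
    using L by blast+
  show "(f, g) \<in> T \<Longrightarrow> (f', g') \<in> T \<Longrightarrow> (f - f', g - g') \<in> T"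
    using add[of f g "- f'" "- g'"] sc[of f' g' "-1"] by (simp add: scaleC_minus_one)
qed

lemma mem_adj_iff: "(g, h) \<in> adj T \<longleftrightarrow> (\<forall>f f'. (f, f') \<in> T \<longrightarrow> cinner f' g = cinner f h)"
  by (auto simp: adjoint_in_def)

lemma closed_adj: "closed (adj T)" for T :: "'a::complex_hilbert operator"
  unfolding closed_sequential_limits
proof (intro allI impI, elim conjE)
  fix x :: "nat \<Rightarrow> 'a \<times> 'a" and l
  assume x: "\<forall>n. x n \<in> adj T" and l: "x \<longlonglongrightarrow> l"
  have 1: "(\<lambda>n. fst (x n)) \<longlonglongrightarrow> fst l" and 2: "(\<lambda>n. snd (x n)) \<longlonglongrightarrow> snd l"
    using l by (auto intro: tendsto_fst tendsto_snd)
  have "cinner f' (fst l) = cinner f (snd l)" if f: "(f, f') \<in> T" for f f'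
  proof (rule LIMSEQ_unique)
    show "(\<lambda>n. cinner f' (fst (x n))) \<longlonglongrightarrow> cinner f' (fst l)" by (intro tendsto_cinner 1 tendsto_const)
    have "cinner f' (fst (x n)) = cinner f (snd (x n))" for n
      using x f mem_adj_iff[of "fst (x n)" "snd (x n)" T] by simp
    then show "(\<lambda>n. cinner f' (fst (x n))) \<longlonglongrightarrow> cinner f (snd l)"
      using tendsto_cinner[OF tendsto_const 2, of f] by simp
  qed
  then show "l \<in> adj T" by (metis mem_adj_iff prod.collapse)
qed

text \<open>
  A lower bound makes the range of \<open>T - z\<close> closed, and a vector orthogonal to it lies in the
  kernel of \<open>T\<^sup>* - cnj z\<close>; so if that kernel is trivial, \<open>T - z\<close> is onto.
\<close>

lemma surjective_if_bounded_below_and_adj_injective: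
  fixes T :: "'a::complex_hilbert operator"
  assumes lin: "linear_operator T" and cl: "closed T"
    and below: "\<And>f g. (f, g) \<in> T \<Longrightarrow> norm f \<le> C * norm (g - scaleC z f)"
    and inj: "\<And>u. (u, scaleC (cnj z) u) \<in> adj T \<Longrightarrow> u = 0"
  shows "\<exists>f. (f, h + scaleC z f) \<in> T"
proof -
  define M where "M = {h. \<exists>f. (f, h + scaleC z f) \<in> T}"
  have "subspace M"
    unfolding subspace_def
  proof (intro conjI ballI allI)
    show "0 \<in> M" using linear_operatorD(1)[OF lin] by (auto simp: M_def intro!: exI[of _ 0])
  next
    fix x y assume "x \<in> M" "y \<in> M"
    then obtain f f' where "(f, x + scaleC z f) \<in> T" "(f', y + scaleC z f') \<in> T" by (auto simp: M_def)
    from linear_operatorD(2)[OF lin this]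
    have "(f + f', (x + y) + scaleC z (f + f')) \<in> T" by (simp add: scaleC_add_right algebra_simps)
    then show "x + y \<in> M" by (auto simp: M_def)
  next
    fix c x assume "x \<in> M"
    then obtain f where "(f, x + scaleC z f) \<in> T" by (auto simp: M_def)
    from linear_operatorD(3)[OF lin this, of "complex_of_real c"]
    have "(c *\<^sub>R f, c *\<^sub>R x + scaleC z (c *\<^sub>R f)) \<in> T"
      by (simp add: scaleC_add_right scaleR_scaleC scaleC_scaleC mult.commute)
    then show "c *\<^sub>R x \<in> M" by (auto simp: M_def)
  qed
  moreover have "closed M"
    unfolding closed_sequential_limits
  proof (intro allI impI, elim conjE)
    fix x l assume x: "\<forall>n. x n \<in> M" and l: "x \<longlonglongrightarrow> l"
    have "\<forall>n. \<exists>f. (f, x n + scaleC z f) \<in> T" using x by (simp add: M_def)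
    then obtain f where f: "\<And>n. (f n, x n + scaleC z (f n)) \<in> T" by metis
    have fC: "norm (f j - f k) \<le> \<bar>C\<bar> * norm (x j - x k)" for j k
    proof -
      have "norm (f j - f k) \<le> C * norm (x j - x k)"
        using below[OF linear_operatorD(4)[OF lin f[of j] f[of k]]]
        by (simp add: cvec.scale_right_diff_distrib algebra_simps)
      also have "\<dots> \<le> \<bar>C\<bar> * norm (x j - x k)" by (intro mult_right_mono) auto
      finally show ?thesis .
    qed
    have "Cauchy f"
    proof (rule metric_CauchyI)
      fix e :: real assume "0 < e"
      then have "0 < e / (\<bar>C\<bar> + 1)" by simp
      then obtain N where N: "\<And>j k. j \<ge> N \<Longrightarrow> k \<ge> N \<Longrightarrow> dist (x j) (x k) < e / (\<bar>C\<bar> + 1)"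
        using LIMSEQ_imp_Cauchy[OF l] unfolding Cauchy_def by metis
      have "dist (f j) (f k) < e" if "j \<ge> N" "k \<ge> N" for j k
      proof -
        have "norm (f j - f k) \<le> (\<bar>C\<bar> + 1) * norm (x j - x k)"
          using fC[of j k] norm_ge_zero[of "x j - x k"] unfolding distrib_right by linarith
        also have "\<dots> < e" using N[OF that] by (simp add: dist_norm field_simps)
        finally show ?thesis by (simp add: dist_norm)
      qed
      then show "\<exists>N. \<forall>j\<ge>N. \<forall>k\<ge>N. dist (f j) (f k) < e" by blast
    qed
    then obtain p where p: "f \<longlonglongrightarrow> p" using Cauchy_convergent convergent_def by blast
    have "(\<lambda>n. (f n, x n + scaleC z (f n))) \<longlonglongrightarrow> (p, l + scaleC z p)"
      by (intro tendsto_intros p l bounded_linear.tendsto[OF bounded_linear_scaleC])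
    from closed_sequentially[OF cl f this] show "l \<in> M" by (auto simp: M_def)
  qed
  moreover have "u = 0" if orth: "\<And>m. m \<in> M \<Longrightarrow> inner m u = 0" for u
  proof (rule inj, unfold mem_adj_iff, intro allI impI)
    fix f f' assume f: "(f, f') \<in> T"
    have m: "scaleC c (f' - scaleC z f) \<in> M" for c
    proof -
      have "(scaleC c f, scaleC c f') \<in> T" by (rule linear_operatorD(3)[OF lin f])
      then show ?thesis unfolding M_def
        by (auto intro!: exI[of _ "scaleC c f"]
            simp: cvec.scale_right_diff_distrib scaleC_scaleC mult.commute)
    qed
    have "cinner (f' - scaleC z f) u = 0"
    proof (rule complex_eqI)
      show "Re (cinner (f' - scaleC z f) u) = Re 0"
        using orth[OF m[of 1]] by (simp add: inner_cinner)
      show "Im (cinner (f' - scaleC z f) u) = Im 0"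
        using orth[OF m[of \<i>]] unfolding inner_cinner cinner_scaleC_left by simp
    qed
    then show "cinner f' u = cinner f (scaleC (cnj z) u)" by (simp add: cinner_simps)
  qed
  ultimately have "h \<in> M" using closed_subspace_orthogonal_vector[of M h] by metis
  then show ?thesis by (simp add: M_def)
qed

text \<open>
  The lower bound comes from the numerical range: for a symmetric operator, or a dissipative one
  and \<open>z\<close> in the lower half-plane, the imaginary part of \<open>((T - z) f, f)\<close> is at least \<open>|Im z| |f|\<^sup>2\<close>
  in modulus.
\<close>

lemma norm_le_if_Im_cinner:
  fixes f g :: "'a::complex_hilbert"
  assumes "\<bar>Im z\<bar> * (norm f)\<^sup>2 \<le> \<bar>Im (cinner (g - scaleC z f) f)\<bar>" and "Im z \<noteq> 0"
  shows "norm f \<le> (1 / \<bar>Im z\<bar>) * norm (g - scaleC z f)"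
proof (cases "f = 0")
  case False
  have "\<bar>Im z\<bar> * (norm f)\<^sup>2 \<le> cmod (cinner (g - scaleC z f) f)"
    using assms(1) abs_Im_le_cmod order_trans by blast
  also have "\<dots> \<le> norm (g - scaleC z f) * norm f" by (rule cauchy_schwarz_cinner)
  finally have "\<bar>Im z\<bar> * norm f \<le> norm (g - scaleC z f)"
    using False by (simp add: power2_eq_square mult.assoc[symmetric])
  then show ?thesis using assms(2) by (simp add: field_simps)
qed simp

lemma closed_if_resolvent_set_nonempty:
  fixes T :: "'a::complex_hilbert operator"
  assumes lin: "linear_operator T" and z: "z \<in> resolvent_set T"
  shows "closed T"
  unfolding closed_sequential_limits
proof (intro allI impI, elim conjE)
  fix x :: "nat \<Rightarrow> 'a \<times> 'a" and l
  assume x: "\<forall>n. x n \<in> T" and l: "x \<longlonglongrightarrow> l"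
  obtain C where C: "\<And>f g. (f, g) \<in> T \<Longrightarrow> norm f \<le> C * norm (g - scaleC z f)"
    using z unfolding resolvent_set_def by blast
  obtain f where f: "(f, (snd l - scaleC z (fst l)) + scaleC z f) \<in> T"
    using z unfolding resolvent_set_def by blast
  have 1: "(\<lambda>n. fst (x n)) \<longlonglongrightarrow> fst l" and 2: "(\<lambda>n. snd (x n)) \<longlonglongrightarrow> snd l"
    using l by (auto intro: tendsto_fst tendsto_snd)
  have "(\<lambda>n. C * norm ((snd (x n) - scaleC z (fst (x n))) - (snd l - scaleC z (fst l))))
      \<longlonglongrightarrow> C * norm ((snd l - scaleC z (fst l)) - (snd l - scaleC z (fst l)))"
    by (intro tendsto_intros 1 2 bounded_linear.tendsto[OF bounded_linear_scaleC])
  then have lim0: "(\<lambda>n. C * norm ((snd (x n) - scaleC z (fst (x n))) - (snd l - scaleC z (fst l)))) \<longlonglongrightarrow> 0"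
    by simp
  have "norm (fst (x n) - f)
      \<le> C * norm ((snd (x n) - scaleC z (fst (x n))) - (snd l - scaleC z (fst l)))" for n
  proof -
    have "(fst (x n), snd (x n)) \<in> T" using x by simp
    from C[OF linear_operatorD(4)[OF lin this f]] show ?thesis
      by (simp add: cvec.scale_right_diff_distrib algebra_simps)
  qed
  then have "(\<lambda>n. fst (x n) - f) \<longlonglongrightarrow> 0"
    by (intro Lim_null_comparison[OF _ lim0]) auto
  then have "(\<lambda>n. fst (x n)) \<longlonglongrightarrow> f" by (simp add: LIM_zero_iff)
  then have "f = fst l" using 1 LIMSEQ_unique by blast
  then show "l \<in> T" using f by simp
qed

lemma selfadjoint_surjective:
  fixes B :: "'a::complex_hilbert operator"
  assumes sa: "selfadjoint_in UNIV B" and z: "Im z \<noteq> 0"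
  shows "\<exists>f. (f, h + scaleC z f) \<in> B"
proof -
  have lin: "linear_operator B" and adj: "adj B = B" using sa by (auto simp: selfadjoint_in_def)
  have real: "Im (cinner g f) = 0" if "(f, g) \<in> B" for f g
  proof -
    have "(f, g) \<in> adj B" using that adj by simp
    then have "cinner g f = cinner f g" using that unfolding mem_adj_iff by blast
    then show ?thesis using cinner_commute[of f g] by (simp add: complex_eq_iff)
  qed
  show ?thesis
  proof (rule surjective_if_bounded_below_and_adj_injective[OF lin, where C = "1 / \<bar>Im z\<bar>"])
    show "closed B" using closed_adj[of B] adj by simp
    show "norm f \<le> 1 / \<bar>Im z\<bar> * norm (g - scaleC z f)" if "(f, g) \<in> B" for f g
      using real[OF that] z
      by (intro norm_le_if_Im_cinner) (simp_all add: cinner_simps cinner_self abs_mult)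
    show "u = 0" if "(u, scaleC (cnj z) u) \<in> adj B" for u
      using real[of u "scaleC (cnj z) u"] that z adj by (simp add: cinner_simps cinner_self)
  qed
qed

section \<open>The impedance function of an \<open>L\<close>-system\<close>

text \<open>
  The channel is determined by the single functional \<open>k = K 1\<close>, so that the state operator is
  \<open>S = R + i K K\<^sup>*\<close>, a rank one perturbation of its symmetric real part \<open>R\<close>.
\<close>

locale one_channel_system =
  fixes \<Theta> :: "'a::complex_hilbert lsys"
  assumes L: "L_system \<Theta>"
begin

abbreviation "A \<equiv> sym_op \<Theta>"
abbreviation "T \<equiv> main_op \<Theta>"
abbreviation "S \<equiv> state_op \<Theta>"
abbreviation "K \<equiv> channel \<Theta>"
abbreviation "P \<equiv> plus_space A"
abbreviation "k \<equiv> K 1"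
abbreviation "R \<equiv> rig_Re A S"
abbreviation "V \<equiv> impedance_function \<Theta>"
abbreviation "W \<equiv> transfer_function \<Theta>"

lemma system_facts:
  shows T_Lambda: "T \<in> class_Lambda A"
    and star: "star_extension A T S"
    and channel: "bounded_channel A K"
    and Im_S: "f \<in> P \<Longrightarrow> rig_Im A S f = K (channel_adj K f)"
  using L unfolding L_system_def Let_def by blast+

lemma plus_space_facts:
  shows P_add: "f \<in> P \<Longrightarrow> g \<in> P \<Longrightarrow> f + g \<in> P"
    and P_scale: "f \<in> P \<Longrightarrow> scaleC c f \<in> P"
proof -
  show "f \<in> P \<Longrightarrow> g \<in> P \<Longrightarrow> f + g \<in> P"
    unfolding plus_space_def Domain_iff mem_adj_iff by (metis cinner_add_right)
  show "f \<in> P \<Longrightarrow> scaleC c f \<in> P"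
    unfolding plus_space_def Domain_iff mem_adj_iff by (metis cinner_scaleC_right)
qed

lemma P_diff: "f \<in> P \<Longrightarrow> g \<in> P \<Longrightarrow> f - g \<in> P"
  using P_add[of f "- g"] P_scale[of g "-1"] by (simp add: scaleC_minus_one)

lemma channel_facts:
  shows K_eq: "K c g = c * k g"
    and k_scale: "g \<in> P \<Longrightarrow> k (scaleC c g) = cnj c * k g"
    and k_add: "g \<in> P \<Longrightarrow> h \<in> P \<Longrightarrow> k (g + h) = k g + k h"
    and k_outside: "g \<notin> P \<Longrightarrow> k g = 0"
proof -
  have km: "k \<in> minus_space A" using channel by (simp add: bounded_channel_def)
  have "K (c * 1) = (\<lambda>g. c * k g)" using channel unfolding bounded_channel_def by blast
  then show "K c g = c * k g" by simp
  show "g \<in> P \<Longrightarrow> k (scaleC c g) = cnj c * k g"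
    and "g \<in> P \<Longrightarrow> h \<in> P \<Longrightarrow> k (g + h) = k g + k h"
    and "g \<notin> P \<Longrightarrow> k g = 0"
    using km unfolding minus_space_def by blast+
qed

lemma S_facts:
  shows S_outside: "f \<in> P \<Longrightarrow> g \<notin> P \<Longrightarrow> S f g = 0"
    and S_add: "f \<in> P \<Longrightarrow> g \<in> P \<Longrightarrow> S (f + g) h = S f h + S g h"
    and S_scale: "f \<in> P \<Longrightarrow> S (scaleC c f) h = c * S f h"
    and S_add_right: "f \<in> P \<Longrightarrow> g \<in> P \<Longrightarrow> h \<in> P \<Longrightarrow> S f (g + h) = S f g + S f h"
    and S_scale_right: "f \<in> P \<Longrightarrow> g \<in> P \<Longrightarrow> S f (scaleC c g) = cnj c * S f g"
proof -
  have b: "bounded_plus_minus A S" using star by (simp add: star_extension_def)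
  have m: "S f \<in> minus_space A" if "f \<in> P" for f
    using b that by (simp add: bounded_plus_minus_def)
  show "f \<in> P \<Longrightarrow> g \<notin> P \<Longrightarrow> S f g = 0"
    and "f \<in> P \<Longrightarrow> g \<in> P \<Longrightarrow> h \<in> P \<Longrightarrow> S f (g + h) = S f g + S f h"
    and "f \<in> P \<Longrightarrow> g \<in> P \<Longrightarrow> S f (scaleC c g) = cnj c * S f g"
    using m[of f] unfolding minus_space_def by blast+
  show "f \<in> P \<Longrightarrow> g \<in> P \<Longrightarrow> S (f + g) h = S f h + S g h"
    and "f \<in> P \<Longrightarrow> S (scaleC c f) h = c * S f h"
    using b unfolding bounded_plus_minus_def by metis+
qed

lemma R_eq: "f \<in> P \<Longrightarrow> g \<in> P \<Longrightarrow> R f g = (S f g + cnj (S g f)) / 2"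
  by (simp add: rig_Re_def rig_adj_def)

lemma R_outside: "f \<in> P \<Longrightarrow> g \<notin> P \<Longrightarrow> R f g = 0"
  by (simp add: rig_Re_def rig_adj_def S_outside)

lemma R_symmetric: "f \<in> P \<Longrightarrow> g \<in> P \<Longrightarrow> R g f = cnj (R f g)"
  by (simp add: R_eq)

lemma R_add: "f \<in> P \<Longrightarrow> g \<in> P \<Longrightarrow> h \<in> P \<Longrightarrow> R (f + g) h = R f h + R g h"
  by (simp add: R_eq S_add S_add_right P_add add_divide_distrib)

lemma R_scale: "f \<in> P \<Longrightarrow> h \<in> P \<Longrightarrow> R (scaleC c f) h = c * R f h"
  by (simp add: R_eq S_scale S_scale_right P_scale field_simps)

lemma R_diff: "f \<in> P \<Longrightarrow> g \<in> P \<Longrightarrow> h \<in> P \<Longrightarrow> R (f - g) h = R f h - R g h"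
  using R_add[of f "- g" h] R_scale[of g h "-1"] P_scale[of g "-1"] by (simp add: scaleC_minus_one)

lemma S_eq_R: "f \<in> P \<Longrightarrow> g \<in> P \<Longrightarrow> S f g = R f g + \<i> * cnj (k f) * k g"
proof -
  assume f: "f \<in> P" and g: "g \<in> P"
  have "rig_Im A S f g = cnj (k f) * k g"
    using Im_S[OF f] K_eq[of "cnj (k f)" g] by (simp add: channel_adj_def)
  then have "S f g - cnj (S g f) = 2 * \<i> * (cnj (k f) * k g)"
    using g by (simp add: rig_Im_def rig_adj_def field_simps)
  then show ?thesis using f g by (simp add: R_eq field_simps)
qed

lemma T_facts:
  shows T_linear: "linear_operator T"
    and T_in: "(f, g) \<in> T \<Longrightarrow> f \<in> P"
    and T_S: "(f, g) \<in> T \<Longrightarrow> h \<in> P \<Longrightarrow> S f h = cinner g h"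
    and adj_T_in: "(f, g) \<in> adj T \<Longrightarrow> f \<in> P"
    and adj_T_S: "(f, g) \<in> adj T \<Longrightarrow> h \<in> P \<Longrightarrow> cnj (S h f) = cinner g h"
proof -
  show "linear_operator T"
    using T_Lambda by (simp add: class_Lambda_def quasi_selfadjoint_extension_def)
  have 1: "rig_extends A S T" and 2: "rig_extends A (rig_adj A S) (adj T)"
    using star by (simp_all add: star_extension_def)
  show "(f, g) \<in> T \<Longrightarrow> f \<in> P" using 1 unfolding rig_extends_def by blast
  show "(f, g) \<in> adj T \<Longrightarrow> f \<in> P" using 2 unfolding rig_extends_def by blast
  show "S f h = cinner g h" if "(f, g) \<in> T" "h \<in> P"
  proof -
    have "S f = embed_minus A g" using 1 that unfolding rig_extends_def by blast
    then show ?thesis using that by (simp add: embed_minus_def)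
  qed
  show "cnj (S h f) = cinner g h" if "(f, g) \<in> adj T" "h \<in> P"
  proof -
    have "rig_adj A S f = embed_minus A g" using 2 that unfolding rig_extends_def by blast
    then have "rig_adj A S f h = embed_minus A g h" by simp
    then show ?thesis using that by (simp add: embed_minus_def rig_adj_def)
  qed
qed

lemma Im_R_self: "f \<in> P \<Longrightarrow> Im (R f f) = 0"
  using R_symmetric[of f f] by (simp add: complex_eq_iff)

lemma Im_S_self: "f \<in> P \<Longrightarrow> Im (S f f) = (cmod (k f))\<^sup>2"
  using Im_R_self[of f] cmod_power2[of "k f"] by (simp add: S_eq_R power2_eq_square)

text \<open>
  Since \<open>Im S = K K\<^sup>*\<close> is nonnegative, \<open>T\<close> is dissipative, which bounds \<open>T - z\<close> from below, and
  \<open>T\<^sup>* \<subseteq> S\<^sup>*\<close> is accumulative, which excludes eigenvectors of \<open>T\<^sup>*\<close> for \<open>cnj z\<close>. In the upper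
  half-plane \<open>T\<close> may have eigenvalues.
\<close>

lemma lower_half_plane_in_resolvent_set:
  assumes z: "Im z < 0"
  shows "z \<in> resolvent_set T"
proof -
  have below: "norm f \<le> 1 / \<bar>Im z\<bar> * norm (g - scaleC z f)" if fg: "(f, g) \<in> T" for f g
  proof (rule norm_le_if_Im_cinner)
    have "Im (cinner g f) = (cmod (k f))\<^sup>2"
      using T_S[OF fg T_in[OF fg]] Im_S_self[OF T_in[OF fg]] by simp
    then have "Im (cinner (g - scaleC z f) f) = (cmod (k f))\<^sup>2 + \<bar>Im z\<bar> * (norm f)\<^sup>2"
      using z by (simp add: cinner_simps cinner_self)
    then show "\<bar>Im z\<bar> * (norm f)\<^sup>2 \<le> \<bar>Im (cinner (g - scaleC z f) f)\<bar>" by simp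
  qed (use z in simp)
  obtain w where "w \<in> resolvent_set T" using T_Lambda by (auto simp: class_Lambda_def)
  then have cl: "closed T" by (rule closed_if_resolvent_set_nonempty[OF T_linear])
  have surj: "\<exists>f. (f, h + scaleC z f) \<in> T" for h
  proof (rule surjective_if_bounded_below_and_adj_injective[OF T_linear cl below])
    fix u assume u: "(u, scaleC (cnj z) u) \<in> adj T"
    have "Im (cnj (S u u)) = - Im z * (norm u)\<^sup>2"
      using adj_T_S[OF u adj_T_in[OF u]] by (simp add: cinner_simps cinner_self)
    then have "(cmod (k u))\<^sup>2 = Im z * (norm u)\<^sup>2"
      using Im_S_self[OF adj_T_in[OF u]] by simp
    then have "0 \<le> Im z * (norm u)\<^sup>2" by (metis zero_le_power2)
    then show "u = 0" using z by (simp add: zero_le_mult_iff)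
  qed
  have uniq: "f = f'" if "(f, h + scaleC z f) \<in> T" "(f', h + scaleC z f') \<in> T" for f f' h
  proof -
    have "(f - f', scaleC z (f - f')) \<in> T"
      using linear_operatorD(4)[OF T_linear that] by (simp add: cvec.scale_right_diff_distrib)
    from below[OF this] show ?thesis by simp
  qed
  show ?thesis
    unfolding resolvent_set_def using surj uniq below by blast
qed

text \<open>
  If \<open>k\<close> vanished on the domain of \<open>T\<close>, then \<open>S\<close> would agree with the symmetric \<open>R\<close> there and \<open>T\<close>
  would be symmetric.
\<close>

lemma exists_k_nonzero: "\<exists>f g. (f, g) \<in> T \<and> k f \<noteq> 0"
proof -
  have "\<not> symmetric_operator T"
    using T_Lambda by (simp add: class_Lambda_def quasi_selfadjoint_extension_def)
  then obtain f g f' g' where fg: "(f, g) \<in> T" "(f', g') \<in> T" and ne: "cinner g' f \<noteq> cinner f' g"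
    unfolding symmetric_operator_def subset_iff by (metis mem_adj_iff prod.collapse)
  have "cinner f' g = cnj (cinner g f')" by (rule cinner_commute)
  also have "\<dots> = cnj (S f f')" using T_S fg T_in by simp
  finally have "S f' f \<noteq> cnj (S f f')" using ne T_S fg T_in by simp
  then have "k f \<noteq> 0"
    using S_eq_R[of f' f] S_eq_R[of f f'] R_symmetric[of f f'] fg T_in by auto
  then show ?thesis using fg by blast
qed

definition resolvent_vector :: "complex \<Rightarrow> 'a" where
  "resolvent_vector z = rig_resolvent A R z k"

lemma impedance_eq: "V z = cnj (k (resolvent_vector z))"
  by (simp add: impedance_function_def channel_adj_def resolvent_vector_def)

text \<open>
  If \<open>k f \<noteq> 0\<close> for some \<open>(f, g) \<in> T\<close>, then \<open>g = R f + i cnj (k f) k\<close> exhibits \<open>k\<close> as a combination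
  of \<open>R f\<close> and the vector \<open>g\<close> of the Hilbert space. The resolvent of the self-adjoint quasi-kernel
  of \<open>R\<close>, which acts on such vectors only, therefore suffices to solve \<open>(R - z) x = k\<close>.
\<close>

lemma exists_resolvent_vector:
  assumes z: "Im z \<noteq> 0"
  shows "\<exists>x\<in>P. \<forall>g\<in>P. R x g - z * cinner x g = k g"
proof -
  obtain f g where fg: "(f, g) \<in> T" and kf: "k f \<noteq> 0" using exists_k_nonzero by blast
  have fP: "f \<in> P" by (rule T_in[OF fg])
  have "selfadjoint_in UNIV (quasi_kernel A R)" using star by (simp add: star_extension_def)
  then obtain h where h: "(h, (g - scaleC z f) + scaleC z h) \<in> quasi_kernel A R"
    using selfadjoint_surjective[OF _ z] by blast
  then have hP: "h \<in> P" by (simp add: quasi_kernel_def)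
  have Rh: "R h x = cinner (g - scaleC z f + scaleC z h) x" if "x \<in> P" for x
    using h that by (simp add: quasi_kernel_def embed_minus_def)
  \<comment> \<open>By the choice of \<open>h\<close>, \<open>(R - z) (f - h) = - i cnj (k f) k\<close>; the factor \<open>c\<close> normalizes this to \<open>k\<close>.\<close>
  define c where "c = 1 / (- \<i> * cnj (k f))"
  have c: "c * (\<i> * cnj (k f)) = - 1" using kf by (simp add: c_def)
  show ?thesis
  proof (intro bexI ballI)
    show "scaleC c (f - h) \<in> P" by (intro P_scale P_diff fP hP)
    fix x assume x: "x \<in> P"
    have "R f x = cinner g x - \<i> * cnj (k f) * k x"
      using S_eq_R[OF fP x] T_S[OF fg x] by simp
    moreover have "R (scaleC c (f - h)) x = c * (R f x - R h x)"
      by (simp only: R_scale[OF P_diff[OF fP hP] x] R_diff[OF fP hP x])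
    moreover have "cinner (scaleC c (f - h)) x = c * (cinner f x - cinner h x)"
      by (simp only: cinner_scaleC_left cinner_diff_left)
    moreover have "R h x = cinner g x - z * cinner f x + z * cinner h x"
      by (simp add: Rh[OF x] cinner_simps)
    ultimately have "R (scaleC c (f - h)) x - z * cinner (scaleC c (f - h)) x
        = - (c * (\<i> * cnj (k f))) * k x"
      by algebra
    then show "R (scaleC c (f - h)) x - z * cinner (scaleC c (f - h)) x = k x" by (simp add: c)
  qed
qed

lemma R_eigenvector_zero:
  assumes z: "Im z \<noteq> 0" and x: "x \<in> P" and eq: "\<And>g. g \<in> P \<Longrightarrow> R x g = z * cinner x g"
  shows "x = 0"
  using eq[OF x] Im_R_self[OF x] z by (simp add: cinner_self)

lemma resolvent_vector:
  assumes z: "Im z \<noteq> 0"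
  shows "resolvent_vector z \<in> P"
    and "g \<in> P \<Longrightarrow> R (resolvent_vector z) g - z * cinner (resolvent_vector z) g = k g"
proof -
  let ?F = "\<lambda>f g. R f g - z * embed_minus A f g"
  obtain x where x: "x \<in> P" and eq: "\<And>g. g \<in> P \<Longrightarrow> R x g - z * cinner x g = k g"
    using exists_resolvent_vector[OF z] by blast
  have "?F x = k"
  proof
    show "?F x g = k g" for g
      using eq[of g] x by (cases "g \<in> P") (simp_all add: embed_minus_def R_outside k_outside)
  qed
  then have "k \<in> ?F ` P" using x by (intro image_eqI[of k ?F x]) simp_all
  from inv_into_into[OF this] f_inv_into_f[OF this]
  have 1: "resolvent_vector z \<in> P" and 2: "?F (resolvent_vector z) = k"
    unfolding resolvent_vector_def rig_resolvent_def by auto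
  show "resolvent_vector z \<in> P" by (rule 1)
  show "R (resolvent_vector z) g - z * cinner (resolvent_vector z) g = k g" if "g \<in> P"
    using fun_cong[OF 2, of g] that by (simp add: embed_minus_def)
qed

lemma impedance_cnj:
  assumes z: "Im z \<noteq> 0"
  shows "V (cnj z) = cnj (V z)"
proof -
  let ?x = "resolvent_vector z" and ?y = "resolvent_vector (cnj z)"
  have z': "Im (cnj z) \<noteq> 0" using z by simp
  note x = resolvent_vector[OF z] and y = resolvent_vector[OF z']
  have "k ?y = R ?x ?y - z * cinner ?x ?y" using x(2)[OF y(1)] by simp
  also have "\<dots> = cnj (R ?y ?x - cnj z * cinner ?y ?x)"
    using R_symmetric[OF y(1) x(1)] by (simp add: cinner_commute[of ?x ?y])
  also have "R ?y ?x - cnj z * cinner ?y ?x = k ?x" using y(2)[OF x(1)] .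
  finally show ?thesis by (simp add: impedance_eq)
qed

lemma Im_impedance:
  assumes z: "Im z \<noteq> 0"
  shows "Im (V z) = Im z * (norm (resolvent_vector z))\<^sup>2"
proof -
  let ?x = "resolvent_vector z"
  note x = resolvent_vector[OF z]
  have "k ?x = R ?x ?x - z * complex_of_real ((norm ?x)\<^sup>2)"
    using x(2)[OF x(1)] by (simp add: cinner_self)
  then show ?thesis using Im_R_self[OF x(1)] by (simp add: impedance_eq)
qed

lemma S_eigenvector_zero:
  assumes z: "Im z < 0" and x: "x \<in> P" and eq: "\<And>g. g \<in> P \<Longrightarrow> S x g = z * cinner x g"
  shows "x = 0"
proof -
  have "(cmod (k x))\<^sup>2 = Im z * (norm x)\<^sup>2"
    using Im_S_self[OF x] eq[OF x] by (simp add: cinner_self)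
  then have "0 \<le> Im z * (norm x)\<^sup>2" by (metis zero_le_power2)
  then show ?thesis using z by (simp add: zero_le_mult_iff)
qed

text \<open>
  The operator \<open>S - z\<close> maps \<open>x = (R - z)\<^sup>-\<^sup>1 K 1\<close> to \<open>(1 + i V z) k\<close>, hence
  \<open>K\<^sup>* (S - z)\<^sup>-\<^sup>1 K = V / (1 + i V)\<close>. In the lower half-plane \<open>Im V \<le> 0\<close>, so that \<open>V\<close> avoids the value
  \<open>i\<close> at which the denominator vanishes.
\<close>

lemma transfer_eq:
  assumes z: "Im z < 0"
  shows "1 + \<i> * V z \<noteq> 0" and "W z = (1 - \<i> * V z) / (1 + \<i> * V z)"
proof -
  have z': "Im z \<noteq> 0" using z by simp
  let ?x = "resolvent_vector z" and ?F = "\<lambda>f g. S f g - z * embed_minus A f g"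
  note x = resolvent_vector[OF z']
  have "Im (V z) \<le> 0" using Im_impedance[OF z'] z by (simp add: mult_nonpos_nonneg)
  then show ne: "1 + \<i> * V z \<noteq> 0" by (auto simp: complex_eq_iff)
  define y where "y = scaleC (1 / (1 + \<i> * V z)) ?x"
  have yP: "y \<in> P" by (simp add: y_def P_scale x)
  have Sx: "S ?x g - z * cinner ?x g = (1 + \<i> * V z) * k g" if g: "g \<in> P" for g
    using x(2)[OF g] by (simp add: S_eq_R[OF x(1) g] impedance_eq algebra_simps)
  have "?F y = k"
  proof
    show "?F y g = k g" for g
    proof (cases "g \<in> P")
      case True
      have "?F y g = 1 / (1 + \<i> * V z) * (S ?x g - z * cinner ?x g)"
        using True by (simp add: y_def embed_minus_def S_scale[OF x(1)] cinner_simps right_diff_distrib)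
      then show ?thesis using Sx[OF True] ne by simp
    qed (use yP in \<open>simp add: embed_minus_def S_outside k_outside\<close>)
  qed
  then have "k \<in> ?F ` P" using yP by (intro image_eqI[of k ?F y]) simp_all
  from inv_into_into[OF this] f_inv_into_f[OF this]
  have 1: "rig_resolvent A S z k \<in> P" and 2: "?F (rig_resolvent A S z k) = k"
    unfolding rig_resolvent_def by auto
  let ?r = "rig_resolvent A S z k"
  have "?r - y = 0"
  proof (rule S_eigenvector_zero[OF z])
    show "?r - y \<in> P" by (intro P_diff 1 yP)
    fix g assume g: "g \<in> P"
    have "S (?r - y) g = S ?r g - S y g"
      using S_add[OF 1, of "- y" g] S_scale[OF yP, of "-1" g] P_scale[OF yP, of "-1"]
      by (simp add: scaleC_minus_one)
    then show "S (?r - y) g = z * cinner (?r - y) g"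
      using fun_cong[OF 2, of g] fun_cong[OF \<open>?F y = k\<close>, of g] g
      by (simp add: embed_minus_def cinner_simps algebra_simps)
  qed
  then have "channel_adj K ?r = cnj (k y)" by (simp add: channel_adj_def)
  also have "\<dots> = V z / (1 + \<i> * V z)"
    by (simp add: y_def k_scale[OF x(1)] impedance_eq)
  finally have "W z = 1 - 2 * \<i> * (V z / (1 + \<i> * V z))"
    by (simp add: transfer_function_def)
  also have "\<dots> = (1 - \<i> * V z) / (1 + \<i> * V z)" using ne by (simp add: field_simps)
  finally show "W z = (1 - \<i> * V z) / (1 + \<i> * V z)" .
qed

end

text \<open>
  Multiplying the Cayley transforms by \<open>- exp (2 i \<alpha>)\<close> rotates the impedance functions. The
  relation between the transfer functions is available on the lower half-plane; the reflection
  \<open>V (cnj z) = cnj (V z)\<close> carries the result to the upper one.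
\<close>

lemma impedance_of_unimodular_transformation:
  assumes uni: "unimodular_transformation \<alpha> \<Theta>' \<Theta>" and cos: "cos \<alpha> \<noteq> 0" and z: "0 < Im z"
  shows "impedance_function \<Theta>' z * (complex_of_real (tan \<alpha>) - impedance_function \<Theta> z)
    = 1 + complex_of_real (tan \<alpha>) * impedance_function \<Theta> z"
proof -
  interpret I: one_channel_system \<Theta>
    using uni by unfold_locales (simp add: unimodular_transformation_def)
  interpret J: one_channel_system \<Theta>'
    using uni by unfold_locales (simp add: unimodular_transformation_def)
  let ?t = "complex_of_real (tan \<alpha>)"
  have lower: "J.V z * (?t - I.V z) = 1 + ?t * I.V z" if z: "Im z < 0" for z
  proof -
    define v u E c s where "v = I.V z" and "u = J.V z" and "E = exp (\<i> * complex_of_real \<alpha>)"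
      and "c = complex_of_real (cos \<alpha>)" and "s = complex_of_real (sin \<alpha>)"
    have E: "E = c + \<i> * s" unfolding E_def c_def s_def
      by (simp add: exp_Euler cos_of_real sin_of_real)
    have "c * c + s * s = complex_of_real ((sin \<alpha>)\<^sup>2 + (cos \<alpha>)\<^sup>2)"
      unfolding c_def s_def power2_eq_square by simp
    then have cs: "c * c + s * s = 1" by (simp only: sin_cos_squared_add of_real_1)
    have EE: "exp (2 * \<i> * complex_of_real \<alpha>) = E * E"
      by (simp add: E_def mult_exp_exp algebra_simps)
    have "J.W z = I.W z * (- exp (2 * \<i> * complex_of_real \<alpha>))"
      using uni I.lower_half_plane_in_resolvent_set[OF z] J.lower_half_plane_in_resolvent_set[OF z]
      unfolding unimodular_transformation_def by blast
    then have "(1 - \<i> * u) / (1 + \<i> * u) = - (E * E) * ((1 - \<i> * v) / (1 + \<i> * v))"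
      unfolding EE I.transfer_eq(2)[OF z] J.transfer_eq(2)[OF z] u_def v_def by simp
    moreover have "1 + \<i> * u \<noteq> 0" "1 + \<i> * v \<noteq> 0"
      unfolding u_def v_def by (rule I.transfer_eq(1)[OF z] J.transfer_eq(1)[OF z])+
    ultimately have "(1 - \<i> * u) * (1 + \<i> * v) + E * E * (1 - \<i> * v) * (1 + \<i> * u) = 0"
      by (simp add: divide_simps)
    \<comment> \<open>Multiplication by \<open>cnj E\<close> makes the relation symmetric in \<open>E\<close> and \<open>cnj E\<close>.\<close>
    then have "(c - \<i> * s) * ((1 - \<i> * u) * (1 + \<i> * v) + E * E * (1 - \<i> * v) * (1 + \<i> * u)) = 0"
      by simp
    moreover have "(c - \<i> * s) * E = 1"
      using cs unfolding E by (simp add: algebra_simps)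
    then have "(c - \<i> * s) * ((1 - \<i> * u) * (1 + \<i> * v) + E * E * (1 - \<i> * v) * (1 + \<i> * u))
        = (c - \<i> * s) * ((1 - \<i> * u) * (1 + \<i> * v)) + E * (1 - \<i> * v) * (1 + \<i> * u)"
      by (simp add: distrib_left flip: mult.assoc)
    moreover have "\<dots> = 2 * (c * (1 + u * v) + s * (v - u))"
      unfolding E by (simp add: algebra_simps)
    ultimately have "2 * (c * (1 + u * v) + s * (v - u)) = 0" by metis
    then have "c * (1 + u * v) + s * (v - u) = 0" by (simp del: distrib_left_numeral)
    moreover have "s = c * ?t" "c \<noteq> 0"
      using cos by (simp_all add: c_def s_def tan_def)
    ultimately have "c * (1 + u * v + ?t * (v - u)) = 0" by (simp add: algebra_simps)
    then have "1 + u * v + ?t * (v - u) = 0" using \<open>c \<noteq> 0\<close> by simp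
    then show ?thesis unfolding u_def[symmetric] v_def[symmetric] by algebra
  qed
  have zc: "Im (cnj z) < 0" and z0: "Im z \<noteq> 0" using z by auto
  have "cnj (J.V z * (?t - I.V z)) = cnj (1 + ?t * I.V z)"
    using lower[OF zc] by (simp add: I.impedance_cnj[OF z0] J.impedance_cnj[OF z0])
  then show ?thesis by (simp only: complex_cnj_cancel_iff)
qed

section \<open>The Herglotz representation on the disc\<close>

abbreviation circle_point :: "real \<Rightarrow> complex" where
  "circle_point t \<equiv> cis (2 * pi * t)"

lemma circle_mean_value:
  assumes h: "h holomorphic_on cball 0 1" and w: "cmod w < 1"
  shows "((\<lambda>t. h (circle_point t) * (circle_point t / (circle_point t - w))) has_integral h w) {0..1}"
proof -
  have e: "exp (2 * of_real pi * \<i> * of_real t) = circle_point t" for t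
    by (simp add: cis_conv_exp mult_ac)
  have c: "circlepath 0 1 t = circle_point t" for t by (simp add: circlepath e)
  have "((\<lambda>u. h u / (u - w)) has_contour_integral (2 * of_real pi * \<i> * h w)) (circlepath 0 1)"
    using h w by (intro Cauchy_integral_circlepath_simple) auto
  then have "((\<lambda>t. h (circle_point t) / (circle_point t - w) * (2 * of_real pi * \<i> * circle_point t))
      has_integral (2 * of_real pi * \<i> * h w)) {0..1}"
    unfolding has_contour_integral_def
    by (rule has_integral_eq[rotated])
      (simp add: vector_derivative_circlepath01 c e)
  then have "((\<lambda>t. 1 / (2 * of_real pi * \<i>) *
        (h (circle_point t) / (circle_point t - w) * (2 * of_real pi * \<i> * circle_point t)))
      has_integral (1 / (2 * of_real pi * \<i>) * (2 * of_real pi * \<i> * h w))) {0..1}"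
    by (rule has_integral_mult_right)
  then show ?thesis by (simp add: field_simps)
qed

text \<open>
  The kernel is \<open>2 \<zeta> / (\<zeta> - w) - 1\<close>; the mean value property for \<open>h\<close> and for the function
  \<open>h / (1 - cnj w \<zeta>)\<close>, conjugated, evaluates the contributions of \<open>h\<close> and of \<open>cnj h\<close>.
\<close>

lemma herglotz_formula_circle:
  assumes h: "h holomorphic_on cball 0 1" and w: "cmod w < 1"
  shows "((\<lambda>t. complex_of_real (Re (h (circle_point t))) *
      ((circle_point t + w) / (circle_point t - w))) has_integral (h w - \<i> * Im (h 0))) {0..1}"
proof -
  have ne: "circle_point t - w \<noteq> 0" for t
    using w norm_cis[of "2 * pi * t"] by auto
  have ne': "1 - cnj w * u \<noteq> 0" if "cmod u \<le> 1" for u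
  proof
    assume "1 - cnj w * u = 0"
    then have "cmod (cnj w * u) = 1" by (metis eq_iff_diff_eq_0 norm_one)
    moreover have "cmod (cnj w * u) \<le> cmod w * 1"
      unfolding norm_mult complex_mod_cnj using that by (intro mult_left_mono) auto
    ultimately show False using w by simp
  qed
  have "(\<lambda>u. h u / (1 - cnj w * u)) holomorphic_on cball 0 1"
    using ne' by (intro holomorphic_intros h) auto
  from circle_mean_value[OF this, of 0]
  have "((\<lambda>t. h (circle_point t) / (1 - cnj w * circle_point t)) has_integral h 0) {0..1}"
    by simp
  from has_integral_cnj[THEN iffD2, OF this]
  have "((\<lambda>t. cnj (h (circle_point t) / (1 - cnj w * circle_point t))) has_integral cnj (h 0)) {0..1}"
    by (simp only: o_def)
  moreover have "cnj (h (circle_point t) / (1 - cnj w * circle_point t))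
      = cnj (h (circle_point t)) * (circle_point t / (circle_point t - w))" for t
  proof -
    have 1: "circle_point t * cnj (circle_point t) = 1"
      using complex_norm_square[of "circle_point t"] by simp
    have "1 - w * cnj (circle_point t) \<noteq> 0"
      using ne'[of "circle_point t"] by (metis cnj.simps complex_cnj_cnj complex_cnj_diff
          complex_cnj_mult complex_cnj_one complex_cnj_zero_iff norm_cis order_refl)
    moreover have "circle_point t * (1 - w * cnj (circle_point t)) = circle_point t - w"
      using 1 by (simp add: right_diff_distrib mult.left_commute)
    ultimately show ?thesis using ne[of t] 
      by (simp add: divide_simps)
  qed
  ultimately have m2: "((\<lambda>t. cnj (h (circle_point t)) * (circle_point t / (circle_point t - w)))
      has_integral cnj (h 0)) {0..1}" by simp
  have m3: "((\<lambda>t. h (circle_point t)) has_integral h 0) {0..1}"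
    using circle_mean_value[OF h, of 0] by simp
  from has_integral_cnj[THEN iffD2, OF this]
  have m4: "((\<lambda>t. cnj (h (circle_point t))) has_integral cnj (h 0)) {0..1}"
    by (simp only: o_def)
  have "((\<lambda>t. (h (circle_point t) * (circle_point t / (circle_point t - w))
        + cnj (h (circle_point t)) * (circle_point t / (circle_point t - w)))
        - (1/2) * (h (circle_point t) + cnj (h (circle_point t))))
      has_integral ((h w + cnj (h 0)) - (1/2) * (h 0 + cnj (h 0)))) {0..1}"
    by (intro has_integral_diff has_integral_add has_integral_mult_right circle_mean_value[OF h w] m2 m3 m4)
  moreover have c: "(h w + cnj (h 0)) - (1/2) * (h 0 + cnj (h 0)) = h w - \<i> * Im (h 0)"
    by (simp add: complex_eq_iff)
  moreover have k: "x * (\<zeta> / (\<zeta> - w)) + cnj x * (\<zeta> / (\<zeta> - w)) - (1/2) * (x + cnj x)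
      = complex_of_real (Re x) * ((\<zeta> + w) / (\<zeta> - w))" if "\<zeta> - w \<noteq> 0" for x \<zeta>
  proof -
    have 1: "x + cnj x = 2 * complex_of_real (Re x)" by (simp add: complex_eq_iff)
    have 2: "(\<zeta> + w) / (\<zeta> - w) = 2 * (\<zeta> / (\<zeta> - w)) - 1" using that by (simp add: field_simps)
    show ?thesis unfolding distrib_right[symmetric] 1 2 by (simp add: algebra_simps)
  qed
  ultimately show ?thesis unfolding c k[OF ne] by simp
qed

lemma norm_herglotz_kernel_le:
  assumes w: "cmod w < 1"
  shows "cmod ((circle_point t + w) / (circle_point t - w)) \<le> 2 / (1 - cmod w)"
proof -
  have "cmod (circle_point t + w) \<le> 2"
    using norm_triangle_ineq[of "circle_point t" w] w by simp
  moreover have "1 - cmod w \<le> cmod (circle_point t - w)"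
    using norm_triangle_ineq2[of "circle_point t" w] by simp
  ultimately show ?thesis using w unfolding norm_divide by (intro frac_le) auto
qed

lemma isCont_herglotz_kernel:
  assumes w: "cmod w < 1"
  shows "isCont (\<lambda>t. (circle_point t + w) / (circle_point t - w)) t"
proof -
  have "circle_point t - w \<noteq> 0" using w norm_cis[of "2 * pi * t"] by auto
  moreover have "isCont circle_point t" unfolding cis_conv_exp by (intro continuous_intros)
  ultimately show ?thesis by (intro continuous_intros) auto
qed

text \<open>
  The measure is a weak limit of the measures with density \<open>t \<mapsto> Re (g (r e\<^sup>2\<^sup>\<pi>\<^sup>i\<^sup>t))\<close> on \<open>[0, 1]\<close> as \<open>r\<close>
  tends to \<open>1\<close>. Living on a common compact interval they are tight, so Helly's selection theorem
  applies; and the kernel is a bounded continuous function of \<open>t\<close> on the whole line, so that its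
  integrals converge.
\<close>

lemma herglotz_representation_disc:
  assumes g: "g holomorphic_on ball 0 1" and pos: "\<And>w. cmod w < 1 \<Longrightarrow> 0 < Re (g w)"
    and g0: "g 0 = 1"
  obtains \<nu> where "real_distribution \<nu>"
    and "\<And>w. cmod w < 1 \<Longrightarrow> g w = (LINT t|\<nu>. (circle_point t + w) / (circle_point t - w))"
proof -
  define r :: "nat \<Rightarrow> real" where "r n = 1 - 1 / real (Suc (Suc n))" for n
  have r: "0 < r n" "r n < 1" for n by (simp_all add: r_def)
  have "(\<lambda>n. 1 - 1 / real (Suc (Suc n))) \<longlonglongrightarrow> 1 - 0"
    using LIMSEQ_Suc[OF LIMSEQ_inverse_real_of_nat]
    by (intro tendsto_diff tendsto_const) (simp add: divide_inverse)
  then have rlim: "r \<longlonglongrightarrow> 1" by (simp add: r_def[abs_def])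
  have rw: "cmod (r n * w) < 1" if "cmod w \<le> 1" for n and w :: complex
  proof -
    have "cmod (r n * w) = r n * cmod w" using r[of n] by (simp add: norm_mult)
    moreover have "r n * cmod w \<le> r n" using r[of n] that by (intro mult_left_le) auto
    ultimately show ?thesis using r(2)[of n] by linarith
  qed
  define h where "h n w = g (r n * w)" for n and w :: complex
  have hol: "h n holomorphic_on cball 0 1" for n
    unfolding h_def using rw
    by (intro holomorphic_on_compose_gen[OF _ g, unfolded o_def] holomorphic_intros) auto
  have h0: "h n 0 = 1" for n by (simp add: h_def g0)
  have hpos: "0 < Re (h n (circle_point t))" for n t unfolding h_def by (intro pos rw) simp
  have hcont: "continuous_on S (\<lambda>t. h n (circle_point t))" for n S
    by (rule continuous_on_compose2[OF holomorphic_on_imp_continuous_on[OF hol]])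
      (auto intro!: continuous_intros)
  have [measurable]: "(\<lambda>t. h n (circle_point t)) \<in> borel_measurable borel" for n
    by (intro borel_measurable_continuous_onI hcont)
  define f where "f n t = indicator {0..1::real} t * Re (h n (circle_point t))" for n t
  have [measurable]: "f n \<in> borel_measurable borel" for n unfolding f_def by measurable
  have f0: "0 \<le> f n t" for n t using hpos[of n t] by (simp add: f_def)
  define \<nu> where "\<nu> n = density lborel (\<lambda>t. ennreal (f n t))" for n
  have [measurable_cong]: "sets (\<nu> n) = sets borel" for n by (simp add: \<nu>_def)
  have int: "has_bochner_integral lborel (\<lambda>t. f n t *\<^sub>R ((circle_point t + w) / (circle_point t - w))) (h n w)"
    if w: "cmod w < 1" for n w
  proof -
    let ?k = "\<lambda>t. complex_of_real (Re (h n (circle_point t))) * ((circle_point t + w) / (circle_point t - w))"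
    have "continuous_on {0..1} ?k"
      using isCont_herglotz_kernel[OF w]
      by (intro continuous_on_mult continuous_on_of_real continuous_on_Re hcont continuous_at_imp_continuous_on)
        auto
    then have si: "set_integrable lborel {0..1} ?k" by (rule borel_integrable_atLeastAtMost')
    have "(LINT t:{0..1}|lborel. ?k t) = h n w"
      using set_borel_integral_eq_integral(2)[OF si] integral_unique[OF herglotz_formula_circle[OF hol w]]
      by (simp add: h0)
    moreover have "indicator {0..1} t *\<^sub>R ?k t = f n t *\<^sub>R ((circle_point t + w) / (circle_point t - w))" for t
      by (simp add: f_def scaleR_conv_of_real indicator_def)
    ultimately show ?thesis
      using si unfolding set_integrable_def set_lebesgue_integral_def
      by (simp add: has_bochner_integral_iff)
  qed
  have "has_bochner_integral lborel (\<lambda>t. f n t *\<^sub>R 1) (1 :: complex)" for n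
    using int[of 0 n] by (simp add: h0)
  from has_bochner_integral_Re[OF this]
  have f1: "has_bochner_integral lborel (f n) 1" for n by simp
  have "prob_space (\<nu> n)" for n
  proof
    have "emeasure (\<nu> n) (space (\<nu> n)) = (\<integral>\<^sup>+t. ennreal (f n t) \<partial>lborel)"
      by (simp add: \<nu>_def emeasure_density)
    also have "\<dots> = ennreal 1"
      using f1[of n] f0 by (subst nn_integral_eq_integral) (auto simp: has_bochner_integral_iff)
    finally show "emeasure (\<nu> n) (space (\<nu> n)) = 1" by simp
  qed
  then have rd: "real_distribution (\<nu> n)" for n
    unfolding real_distribution_def real_distribution_axioms_def by (simp add: \<nu>_def)
  have "measure (\<nu> n) {-1<..1} = 1" for n
  proof -
    interpret real_distribution "\<nu> n" by (rule rd)
    have "AE t in \<nu> n. t \<in> {-1<..1}"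
      unfolding \<nu>_def by (subst AE_density) (auto simp: f_def indicator_def)
    then show ?thesis by (simp add: prob_eq_1)
  qed
  then have "tight \<nu>"
    unfolding tight_def using rd
    by (intro conjI allI impI exI[where x = "-1"] exI[where x = 1]) auto
  then obtain s M where s: "strict_mono s" and M: "real_distribution M"
    and conv: "weak_conv_m (\<nu> \<circ> id \<circ> s) M"
    using tight_imp_convergent_subsubsequence[of \<nu> id] by (auto simp: strict_mono_def)
  show thesis
  proof
    show "real_distribution M" by (rule M)
    fix w :: complex assume w: "cmod w < 1"
    let ?k = "\<lambda>t. (circle_point t + w) / (circle_point t - w)"
    have [measurable]: "?k \<in> borel_measurable borel"
      using isCont_herglotz_kernel[OF w]
      by (intro borel_measurable_continuous_onI continuous_at_imp_continuous_on) auto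
    have "(\<lambda>n. integral\<^sup>L ((\<nu> \<circ> id \<circ> s) n) ?k) \<longlonglongrightarrow> integral\<^sup>L M ?k"
      using rd M conv isCont_herglotz_kernel[OF w] norm_herglotz_kernel_le[OF w]
      by (intro weak_conv_imp_integral_bdd_continuous_conv) (auto simp: o_def)
    moreover have "integral\<^sup>L (\<nu> n) ?k = h n w" for n
      using int[OF w, of n] f0 unfolding \<nu>_def
      by (subst integral_density) (auto simp: has_bochner_integral_iff)
    ultimately have "(\<lambda>n. h (s n) w) \<longlonglongrightarrow> integral\<^sup>L M ?k" by simp
    moreover have "(\<lambda>n. h (s n) w) \<longlonglongrightarrow> g w"
    proof -
      have "isCont g w"
        using g w by (intro continuous_on_interior[OF holomorphic_on_imp_continuous_on[OF g]]) auto
      moreover have "(\<lambda>n. complex_of_real (r (s n)) * w) \<longlonglongrightarrow> complex_of_real 1 * w"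
        using LIMSEQ_subseq_LIMSEQ[OF rlim s] by (intro tendsto_intros) (simp add: o_def)
      ultimately show ?thesis unfolding h_def using isCont_tendsto_compose[of w g] by simp
    qed
    ultimately show "g w = integral\<^sup>L M ?k" by (rule LIMSEQ_unique[rotated])
  qed
qed

section \<open>The Herglotz representation on the half-plane\<close>

text \<open>
  The Cayley transform \<open>w = (z - i) / (z + i)\<close> turns the kernel of the disc into a fractional linear
  function of \<open>z\<close>; in terms of \<open>\<lambda> = - cot (\<pi> t)\<close> it is \<open>(1 + \<lambda> z) / (\<lambda> - z)\<close>, while it is \<open>z\<close> at the
  parameters with \<open>sin (\<pi> t) = 0\<close>, which correspond to the point at infinity.
\<close>

lemma herglotz_representation_half_plane:
  assumes F: "herglotz_nevanlinna F"
  obtains \<nu> where "real_distribution \<nu>"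
    and "\<And>z. 0 < Im z \<Longrightarrow> F z = complex_of_real (Re (F \<i>)) + complex_of_real (Im (F \<i>)) *
      (LINT t|\<nu>. (complex_of_real (cos (pi * t)) * z - complex_of_real (sin (pi * t))) /
        (complex_of_real (sin (pi * t)) * z + complex_of_real (cos (pi * t))))"
proof -
  define q a where "q = Re (F \<i>)" and "a = Im (F \<i>)"
  have hol: "F holomorphic_on {z. 0 < Im z}" and pos: "\<And>z. 0 < Im z \<Longrightarrow> 0 < Im (F z)"
    using F by (auto simp: herglotz_nevanlinna_def)
  have a: "0 < a" using pos[of \<i>] by (simp add: a_def)
  \<comment> \<open>\<open>\<phi>\<close> maps the disc to the upper half-plane and \<open>0\<close> to \<open>i\<close>; \<open>g\<close> is normalized to \<open>g 0 = 1\<close>.\<close>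
  define \<phi> where "\<phi> w = \<i> * (1 + w) / (1 - w)" for w :: complex
  have \<phi>: "0 < Im (\<phi> w)" if w: "cmod w < 1" for w
  proof -
    have "1 - w \<noteq> 0" using w by auto
    have "\<phi> w = \<i> * ((1 + w) * cnj (1 - w)) / complex_of_real ((cmod (1 - w))\<^sup>2)"
      by (simp add: \<phi>_def complex_div_cnj[of _ "1 - w"] mult.assoc)
    then have "Im (\<phi> w) = Re ((1 + w) * cnj (1 - w)) / (cmod (1 - w))\<^sup>2"
      by (simp only: Im_divide_of_real Im_i_times mult.assoc)
    moreover have "Re ((1 + w) * cnj (1 - w)) = 1 - (cmod w)\<^sup>2"
      using cmod_power2[of w] by (simp add: power2_eq_square algebra_simps)
    moreover have "(cmod w)\<^sup>2 < 1" using w by (simp add: power_less_one_iff abs_square_less_1)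
    ultimately show ?thesis using \<open>1 - w \<noteq> 0\<close> by simp
  qed
  define g where "g w = - \<i> * (F (\<phi> w) - complex_of_real q) / complex_of_real a" for w
  have "g holomorphic_on ball 0 1"
  proof -
    have "\<phi> holomorphic_on ball 0 1" unfolding \<phi>_def by (intro holomorphic_intros) auto
    moreover have "\<phi> ` ball 0 1 \<subseteq> {z. 0 < Im z}" using \<phi> by auto
    ultimately have "(\<lambda>w. F (\<phi> w)) holomorphic_on ball 0 1"
      using holomorphic_on_compose_gen[OF _ hol, of \<phi>] by (simp add: o_def)
    then show ?thesis unfolding g_def using a by (intro holomorphic_intros) auto
  qed
  moreover have "0 < Re (g w)" if "cmod w < 1" for w
    using pos[OF \<phi>[OF that]] a by (simp add: g_def)
  moreover have "g 0 = 1"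
    using a by (simp add: g_def \<phi>_def q_def a_def complex_eq_iff)
  ultimately obtain \<nu> where \<nu>: "real_distribution \<nu>"
    and rep: "\<And>w. cmod w < 1 \<Longrightarrow> g w = (LINT t|\<nu>. (circle_point t + w) / (circle_point t - w))"
    using herglotz_representation_disc[of g] by metis
  have "F z = complex_of_real q + complex_of_real a *
      (LINT t|\<nu>. (complex_of_real (cos (pi * t)) * z - complex_of_real (sin (pi * t))) /
        (complex_of_real (sin (pi * t)) * z + complex_of_real (cos (pi * t))))"
    if z: "0 < Im z" for z
  proof -
    define w where "w = (z - \<i>) / (z + \<i>)"
    have zi: "z + \<i> \<noteq> 0" using z by (auto simp: complex_eq_iff)
    have "(cmod (z - \<i>))\<^sup>2 < (cmod (z + \<i>))\<^sup>2"
      using z unfolding cmod_power2 by (simp add: power2_eq_square algebra_simps)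
    then have "cmod (z - \<i>) < cmod (z + \<i>)" by (rule power_less_imp_less_base) simp
    then have w: "cmod w < 1" using zi by (simp add: w_def norm_divide)
    have "1 + w = 2 * z / (z + \<i>)" "1 - w = 2 * \<i> / (z + \<i>)"
      using zi by (simp_all add: w_def field_simps)
    then have "\<phi> w = z" using zi by (simp add: \<phi>_def)
    then have "F z = complex_of_real q + complex_of_real a * (\<i> * g w)"
      using a by (simp add: g_def)
    also have "\<i> * g w = (LINT t|\<nu>. \<i> * ((circle_point t + w) / (circle_point t - w)))"
      unfolding rep[OF w] by (rule integral_mult_right_zero[symmetric])
    also have "(\<lambda>t. \<i> * ((circle_point t + w) / (circle_point t - w))) =
        (\<lambda>t. (complex_of_real (cos (pi * t)) * z - complex_of_real (sin (pi * t))) /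
          (complex_of_real (sin (pi * t)) * z + complex_of_real (cos (pi * t))))"
    proof
      fix t
      define c s where "c = complex_of_real (cos (pi * t))" and "s = complex_of_real (sin (pi * t))"
      define e where "e = circle_point t"
      have ec: "e = (c + \<i> * s)\<^sup>2"
      proof -
        have "e = (cis (pi * t))\<^sup>2" by (simp add: e_def Complex.DeMoivre mult.assoc)
        also have "cis (pi * t) = c + \<i> * s" by (simp add: c_def s_def complex_eq_iff)
        finally show ?thesis .
      qed
      have "c\<^sup>2 + s\<^sup>2 = complex_of_real ((sin (pi * t))\<^sup>2 + (cos (pi * t))\<^sup>2)"
        by (simp only: c_def s_def of_real_add of_real_power add.commute)
      then have cs: "c\<^sup>2 + s\<^sup>2 = 1" by (simp only: sin_cos_squared_add of_real_1)
      have qne: "c + \<i> * s \<noteq> 0"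
      proof
        assume "c + \<i> * s = 0"
        then have "(c + \<i> * s) * (c - \<i> * s) = 0" by simp
        then have "c\<^sup>2 + s\<^sup>2 = 0" by (simp add: power2_eq_square algebra_simps)
        then show False using cs by simp
      qed
      have p: "e * (z + \<i>) + (z - \<i>) = (c + \<i> * s) * (2 * (c * z - s))"
        using cs i_squared unfolding ec by algebra
      have m: "e * (z + \<i>) - (z - \<i>) = (c + \<i> * s) * (2 * (\<i> * (s * z + c)))"
        using cs i_squared unfolding ec by algebra
      have "(e + w) / (e - w) = (e * (z + \<i>) + (z - \<i>)) / (e * (z + \<i>) - (z - \<i>))"
      proof -
        have "e + w = (e * (z + \<i>) + (z - \<i>)) / (z + \<i>)"
          and "e - w = (e * (z + \<i>) - (z - \<i>)) / (z + \<i>)"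
          using zi by (simp_all add: w_def add_divide_distrib diff_divide_distrib)
        then show ?thesis using zi by simp
      qed
      also have "\<dots> = (c * z - s) / (\<i> * (s * z + c))"
        unfolding p m using qne by (simp del: right_diff_distrib_numeral distrib_left_numeral)
      finally show "\<i> * ((circle_point t + w) / (circle_point t - w)) = (c * z - s) / (s * z + c)"
        unfolding e_def by (simp add: mult.commute)
    qed
    finally show ?thesis .
  qed
  then show thesis using that \<nu> unfolding q_def a_def by blast
qed

lemma herglotz_kernel_eq:
  fixes x :: real and z :: complex
  assumes z: "Im z \<noteq> 0"
  shows "1 / (complex_of_real x - z) - complex_of_real (x / (1 + x\<^sup>2))
    = (1 + complex_of_real x * z) / (complex_of_real x - z) * complex_of_real (1 / (1 + x\<^sup>2))"
proof -
  have 1: "complex_of_real x - z \<noteq> 0" using z by (auto simp: complex_eq_iff)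
  have "1 + x\<^sup>2 \<noteq> 0" by (smt (verit) zero_le_power2)
  then have "complex_of_real (1 + x\<^sup>2) \<noteq> 0" by (simp only: of_real_eq_0_iff not_False_eq_True)
  then have "1 / (complex_of_real x - z) - x / complex_of_real (1 + x\<^sup>2)
    = (1 + complex_of_real x * z) / (complex_of_real x - z) * (1 / complex_of_real (1 + x\<^sup>2))"
    using 1 by (simp add: field_simps power2_eq_square)
  then show ?thesis by simp
qed

text \<open>
  The denominator \<open>d\<close> cannot be small: its imaginary part is \<open>sin x Im z\<close>, and \<open>cos x = d - sin x z\<close>,
  while \<open>sin x\<close> and \<open>cos x\<close> are not both small.
\<close>

lemma norm_boundary_kernel_le:
  fixes x :: real
  assumes z: "0 < Im z"
  shows "cmod ((complex_of_real (cos x) * z - complex_of_real (sin x)) /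
      (complex_of_real (sin x) * z + complex_of_real (cos x)))
    \<le> (cmod z + 1) * (1 + (cmod z + 1) / Im z)"
proof -
  let ?n = "complex_of_real (cos x) * z - complex_of_real (sin x)"
    and ?d = "complex_of_real (sin x) * z + complex_of_real (cos x)"
  have n: "cmod ?n \<le> cmod z + 1"
  proof -
    have "cmod ?n \<le> \<bar>cos x\<bar> * cmod z + \<bar>sin x\<bar>"
      using norm_triangle_ineq4[of "complex_of_real (cos x) * z" "complex_of_real (sin x)"]
      by (simp add: norm_mult)
    also have "\<dots> \<le> 1 * cmod z + 1" by (intro add_mono mult_right_mono) auto
    finally show ?thesis by simp
  qed
  have s: "\<bar>sin x\<bar> \<le> cmod ?d / Im z"
    using abs_Im_le_cmod[of ?d] z by (simp add: abs_mult field_simps)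
  have "\<bar>cos x\<bar> \<le> cmod ?d + \<bar>sin x\<bar> * cmod z"
    using norm_triangle_ineq4[of ?d "complex_of_real (sin x) * z"] by (simp add: norm_mult)
  also have "\<dots> \<le> cmod ?d + cmod ?d / Im z * cmod z" by (intro add_mono mult_right_mono s) auto
  finally have c: "\<bar>cos x\<bar> \<le> cmod ?d + cmod ?d / Im z * cmod z" .
  have "1 = \<bar>sin x\<bar> * \<bar>sin x\<bar> + \<bar>cos x\<bar> * \<bar>cos x\<bar>"
    using sin_cos_squared_add[of x] by (simp add: power2_eq_square)
  also have "\<dots> \<le> \<bar>sin x\<bar> * 1 + \<bar>cos x\<bar> * 1" by (intro add_mono mult_left_mono) auto
  also have "\<dots> \<le> cmod ?d * (1 + (cmod z + 1) / Im z)"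
    using s c by (simp add: algebra_simps add_divide_distrib)
  finally have d: "1 \<le> cmod ?d * (1 + (cmod z + 1) / Im z)" .
  then have "cmod ?d \<noteq> 0" by auto
  then have "1 / cmod ?d \<le> 1 + (cmod z + 1) / Im z"
    using d by (simp add: divide_le_eq mult.commute)
  then have "cmod ?n * (1 / cmod ?d) \<le> (cmod z + 1) * (1 + (cmod z + 1) / Im z)"
    using n by (intro mult_mono) auto
  then show ?thesis by (simp add: norm_divide)
qed

text \<open>
  At \<open>z = i y\<close> the imaginary part of the kernel is nonnegative, and it equals \<open>y\<close> at the parameters
  that correspond to infinity. Positive mass there would give \<open>Im F (i y) \<ge> \<epsilon> y\<close> for some
  \<open>\<epsilon> > 0\<close> and all \<open>y\<close>. In its absence the substitution \<open>\<lambda> = - cot (\<pi> t)\<close> moves the measure to the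
  real line, where the weight \<open>1 + \<lambda>\<^sup>2\<close> turns the kernel \<open>(1 + \<lambda> z) / (\<lambda> - z)\<close> into the one stated.
\<close>

lemma herglotz_representation_without_linear_term:
  assumes F: "herglotz_nevanlinna F"
    and sub: "\<And>\<epsilon>. 0 < \<epsilon> \<Longrightarrow> \<exists>y>0. Im (F (\<i> * complex_of_real y)) < \<epsilon> * y"
  obtains \<mu> :: "real measure" where "sets \<mu> = sets borel"
    and "has_bochner_integral \<mu> (\<lambda>t. 1 / (1 + t\<^sup>2)) (Im (F \<i>))"
    and "\<forall>z. 0 < Im z \<longrightarrow> F z = complex_of_real (Re (F \<i>)) +
      (LINT t|\<mu>. (1 / (complex_of_real t - z) - complex_of_real (t / (1 + t\<^sup>2))))"
proof -
  define a where "a = Im (F \<i>)"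
  have a: "0 < a" using F by (auto simp: herglotz_nevanlinna_def a_def image_subset_iff)
  obtain \<nu> where \<nu>: "real_distribution \<nu>"
    and rep: "\<And>z. 0 < Im z \<Longrightarrow> F z = complex_of_real (Re (F \<i>)) + complex_of_real (Im (F \<i>)) *
      (LINT t|\<nu>. (complex_of_real (cos (pi * t)) * z - complex_of_real (sin (pi * t))) /
        (complex_of_real (sin (pi * t)) * z + complex_of_real (cos (pi * t))))"
    using herglotz_representation_half_plane[OF F] by blast
  interpret real_distribution \<nu> by (rule \<nu>)
  define N where "N = {t. sin (pi * t) = 0}"
  have Nb [measurable]: "N \<in> sets borel" unfolding N_def by measurable
  have "prob N = 0"
  proof (rule ccontr)
    assume "prob N \<noteq> 0"
    then have pN: "0 < prob N" using measure_nonneg[of \<nu> N] by linarith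
    then obtain y where y: "0 < y" and small: "Im (F (\<i> * complex_of_real y)) < a * prob N * y"
      using sub[of "a * prob N"] a by auto
    let ?D = "\<lambda>t. (cos (pi * t))\<^sup>2 + (sin (pi * t) * y)\<^sup>2"
    have Dpos: "0 < ?D t" for t
    proof -
      have "cos (pi * t) \<noteq> 0 \<or> sin (pi * t) * y \<noteq> 0"
        using sin_zero_norm_cos_one[of "pi * t"] y by auto
      then show ?thesis by (metis sum_power2_gt_zero_iff)
    qed
    let ?k = "\<lambda>t. (complex_of_real (cos (pi * t)) * (\<i> * complex_of_real y) - complex_of_real (sin (pi * t))) /
        (complex_of_real (sin (pi * t)) * (\<i> * complex_of_real y) + complex_of_real (cos (pi * t)))"
    have Imk: "Im (?k t) = y / ?D t" for t
    proof -
      have "Im (?k t) = (cos (pi * t) * y * cos (pi * t) + sin (pi * t) * (sin (pi * t) * y)) / ?D t"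
        by (simp add: Im_divide)
      also have "cos (pi * t) * y * cos (pi * t) + sin (pi * t) * (sin (pi * t) * y)
          = y * ((sin (pi * t))\<^sup>2 + (cos (pi * t))\<^sup>2)" by (simp add: power2_eq_square algebra_simps
            del: sin_cos_squared_add sin_cos_squared_add2 sin_cos_squared_add3)
      finally show ?thesis by simp
    qed
    have int: "integrable \<nu> ?k"
      using y by (intro integrable_const_bound[OF AE_I2[OF norm_boundary_kernel_le]]) auto
    have "prob N * y = (LINT t|\<nu>. indicator N t * y)" by simp
    also have "\<dots> \<le> (LINT t|\<nu>. Im (?k t))"
    proof (rule integral_mono)
      show "integrable \<nu> (\<lambda>t. Im (?k t))" using int by (rule integrable_Im)
      show "indicator N t * y \<le> Im (?k t)" for t
      proof (cases "t \<in> N")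
        case True
        then have "sin (pi * t) = 0" by (simp add: N_def)
        then show ?thesis using sin_cos_squared_add[of "pi * t"] True unfolding Imk by simp
      qed (use Dpos[of t] y in \<open>simp add: Imk\<close>)
      show "integrable \<nu> (\<lambda>t. indicator N t * y)"
        by (rule integrable_const_bound[where B = y]) (use y in \<open>auto simp: indicator_def\<close>)
    qed
    also have "\<dots> = Im (LINT t|\<nu>. ?k t)" by (rule integral_Im[OF int])
    finally have "a * (prob N * y) \<le> a * Im (LINT t|\<nu>. ?k t)" using a by (intro mult_left_mono) auto
    also have "\<dots> = Im (F (\<i> * complex_of_real y))"
      using rep[of "\<i> * complex_of_real y"] y by (simp add: a_def)
    finally have "a * prob N * y \<le> Im (F (\<i> * complex_of_real y))" by (simp add: mult.assoc)
    then show False using small by simp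
  qed
  then have AEN: "AE t in \<nu>. sin (pi * t) \<noteq> 0"
    using Nb AE_iff_measurable[of N \<nu> "\<lambda>t. sin (pi * t) \<noteq> 0"]
    by (simp add: N_def emeasure_eq_measure)
  define l where "l t = - cos (pi * t) / sin (pi * t)" for t
  have [measurable]: "l \<in> borel_measurable borel" unfolding l_def by measurable
  define \<mu> where "\<mu> = distr (density \<nu> (\<lambda>t. ennreal (a * (1 + (l t)\<^sup>2)))) borel l"
  have nn: "0 \<le> a * (1 + (l t)\<^sup>2)" for t using a by simp
  have transport: "has_bochner_integral \<mu> f x"
    if f [measurable]: "f \<in> borel_measurable borel"
      and "has_bochner_integral \<nu> (\<lambda>t. (a * (1 + (l t)\<^sup>2)) *\<^sub>R f (l t)) x"
    for f :: "real \<Rightarrow> complex" and x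
    unfolding \<mu>_def
    using that(2) nn
    by (subst has_bochner_integral_distr) (auto intro!: has_bochner_integral_density)
  have l0: "1 + (l t)\<^sup>2 \<noteq> 0" for t by (smt (verit) zero_le_power2)
  show thesis
  proof
    show "sets \<mu> = sets borel" by (simp add: \<mu>_def)
    have "has_bochner_integral \<mu> (\<lambda>t. complex_of_real (1 / (1 + t\<^sup>2))) (complex_of_real a)"
    proof (rule transport)
      have "(\<lambda>t. (a * (1 + (l t)\<^sup>2)) *\<^sub>R complex_of_real (1 / (1 + (l t)\<^sup>2))) = (\<lambda>t. complex_of_real a)"
        using l0 by (simp add: scaleR_conv_of_real flip: of_real_mult of_real_divide)
      then show "has_bochner_integral \<nu> (\<lambda>t. (a * (1 + (l t)\<^sup>2)) *\<^sub>R complex_of_real (1 / (1 + (l t)\<^sup>2)))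
          (complex_of_real a)"
        using prob_space by (simp add: has_bochner_integral_iff)
    qed measurable
    from has_bochner_integral_Re[OF this]
    show "has_bochner_integral \<mu> (\<lambda>t. 1 / (1 + t\<^sup>2)) (Im (F \<i>))" by (simp add: a_def)
    show "\<forall>z. 0 < Im z \<longrightarrow> F z = complex_of_real (Re (F \<i>)) +
      (LINT t|\<mu>. (1 / (complex_of_real t - z) - complex_of_real (t / (1 + t\<^sup>2))))"
    proof (intro allI impI)
      fix z :: complex assume z: "0 < Im z"
      let ?f = "\<lambda>t. 1 / (complex_of_real t - z) - complex_of_real (t / (1 + t\<^sup>2))"
      let ?k = "\<lambda>t. (complex_of_real (cos (pi * t)) * z - complex_of_real (sin (pi * t))) /
          (complex_of_real (sin (pi * t)) * z + complex_of_real (cos (pi * t)))"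
      have ae: "AE t in \<nu>. (a * (1 + (l t)\<^sup>2)) *\<^sub>R ?f (l t) = complex_of_real a * ?k t"
        using AEN
      proof eventually_elim
        case (elim t)
        define c s where "c = complex_of_real (cos (pi * t))" and "s = complex_of_real (sin (pi * t))"
        have s: "s \<noteq> 0" using elim by (simp add: s_def)
        have lt: "complex_of_real (l t) = - c / s" by (simp add: l_def c_def s_def)
        have 1: "complex_of_real (l t) - z = - (s * z + c) / s"
          unfolding lt using s by (simp add: field_simps)
        have 2: "1 + complex_of_real (l t) * z = - (c * z - s) / s"
          unfolding lt using s by (simp add: field_simps)
        have "(1 + l t * z) / (l t - z) = (c * z - s) / (s * z + c)"
          unfolding 1 2 minus_divide_left[symmetric] minus_divide_divide
          using s by (simp add: divide_divide_eq_left' divide_divide_eq_right)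
        moreover have "(a * (1 + (l t)\<^sup>2)) *\<^sub>R ?f (l t)
            = (1 + complex_of_real (l t) * z) / (complex_of_real (l t) - z) * complex_of_real a"
          using herglotz_kernel_eq[where z = z and x = "l t"] z l0[of t]
          by (simp add: scaleR_conv_of_real del: of_real_add of_real_power of_real_divide
              flip: of_real_mult mult.assoc)
        ultimately show ?case by (simp add: c_def s_def mult.commute)
      qed
      have int: "integrable \<nu> ?k"
        by (intro integrable_const_bound[OF AE_I2[OF norm_boundary_kernel_le[OF z]]]) auto
      have "has_bochner_integral \<nu> (\<lambda>t. (a * (1 + (l t)\<^sup>2)) *\<^sub>R ?f (l t))
          (complex_of_real a * integral\<^sup>L \<nu> ?k)"
      proof (rule has_bochner_integral_cong_AE[THEN iffD2, OF _ _ ae])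
        show "has_bochner_integral \<nu> (\<lambda>t. complex_of_real a * ?k t) (complex_of_real a * integral\<^sup>L \<nu> ?k)"
          by (intro has_bochner_integral_mult_right has_bochner_integral_integrable int)
      qed measurable
      then have "has_bochner_integral \<mu> ?f (complex_of_real a * integral\<^sup>L \<nu> ?k)"
        by (intro transport) auto
      then show "F z = complex_of_real (Re (F \<i>)) + integral\<^sup>L \<mu> ?f"
        using rep[OF z] by (simp add: has_bochner_integral_iff a_def)
    qed
  qed
qed

section \<open>Asymptotics along the imaginary axis\<close>

locale herglotz_integral =
  fixes \<mu> :: "real measure" and V :: "complex \<Rightarrow> complex" and q a :: real
  assumes sets_\<mu> [measurable_cong]: "sets \<mu> = sets borel"
    and weight: "has_bochner_integral \<mu> (\<lambda>t. 1 / (1 + t\<^sup>2)) a"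
    and rep: "0 < Im z \<Longrightarrow> V z = complex_of_real q +
      (LINT t|\<mu>. (1 / (complex_of_real t - z) - complex_of_real (t / (1 + t\<^sup>2))))"
begin

abbreviation kernel :: "real \<Rightarrow> real \<Rightarrow> complex" where
  "kernel y t \<equiv> 1 / (complex_of_real t - \<i> * complex_of_real y) - complex_of_real (t / (1 + t\<^sup>2))"

lemma rep_imaginary_axis:
  "0 < y \<Longrightarrow> V (\<i> * complex_of_real y) = complex_of_real q + (LINT t|\<mu>. kernel y t)"
  using rep[of "\<i> * complex_of_real y"] by simp

lemma value_at_i: "V \<i> = Complex q a"
proof -
  have "kernel 1 t = \<i> * complex_of_real (1 / (1 + t\<^sup>2))" for t
  proof -
    have "1 + t\<^sup>2 \<noteq> 0" by (smt (verit) zero_le_power2)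
    then have 1: "1 + (complex_of_real t)\<^sup>2 \<noteq> 0" by (metis of_real_1 of_real_add of_real_eq_0_iff of_real_power)
    have 2: "(complex_of_real t - \<i>) * (complex_of_real t + \<i>) = 1 + (complex_of_real t)\<^sup>2"
      by (simp add: power2_eq_square algebra_simps)
    have 3: "complex_of_real t - \<i> \<noteq> 0" by (auto simp: complex_eq_iff)
    have "1 / (complex_of_real t - \<i>) = (complex_of_real t + \<i>) / (1 + (complex_of_real t)\<^sup>2)"
      using 1 2 3 by (simp add: divide_simps mult.commute)
    then show ?thesis by (simp add: add_divide_distrib)
  qed
  moreover have "has_bochner_integral \<mu> (\<lambda>t. \<i> * complex_of_real (1 / (1 + t\<^sup>2))) (\<i> * complex_of_real a)"
    by (intro has_bochner_integral_mult_right has_bochner_integral_of_real weight)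
  ultimately have "(LINT t|\<mu>. kernel 1 t) = \<i> * complex_of_real a"
    by (simp add: has_bochner_integral_iff)
  then show ?thesis using rep_imaginary_axis[of 1] by (simp add: complex_eq_iff)
qed

lemma norm_kernel_le: "1 \<le> y \<Longrightarrow> cmod (kernel y t) \<le> y * (1 / (1 + t\<^sup>2))"
proof -
  assume y: "1 \<le> y"
  let ?z = "\<i> * complex_of_real y"
  have "(cmod (1 + complex_of_real t * ?z))\<^sup>2 = 1 + (t * y)\<^sup>2" by (simp add: cmod_power2)
  also have "\<dots> \<le> y\<^sup>2 * (t\<^sup>2 + y\<^sup>2)"
  proof -
    have "1 \<le> y\<^sup>2 * y\<^sup>2" using y mult_mono[of 1 "y\<^sup>2" 1 "y\<^sup>2"] by (simp add: one_le_power)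
    then show ?thesis by (simp add: algebra_simps power_mult_distrib)
  qed
  also have "\<dots> = (y * cmod (complex_of_real t - ?z))\<^sup>2" by (simp add: power_mult_distrib cmod_power2)
  finally have "cmod (1 + complex_of_real t * ?z) \<le> y * cmod (complex_of_real t - ?z)"
    using y by (intro power2_le_imp_le[of "cmod (1 + complex_of_real t * ?z)"]) auto
  moreover have "complex_of_real t - ?z \<noteq> 0" using y by (auto simp: complex_eq_iff)
  ultimately have "cmod ((1 + complex_of_real t * ?z) / (complex_of_real t - ?z)) \<le> y"
    by (simp add: norm_divide divide_le_eq)
  then have "cmod ((1 + complex_of_real t * ?z) / (complex_of_real t - ?z)) * (1 / (1 + t\<^sup>2))
      \<le> y * (1 / (1 + t\<^sup>2))"
    by (intro mult_right_mono) auto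
  moreover have "cmod (kernel y t)
      = cmod ((1 + complex_of_real t * ?z) / (complex_of_real t - ?z)) * (1 / (1 + t\<^sup>2))"
  proof -
    have "Im ?z \<noteq> 0" using y by simp
    then show ?thesis unfolding herglotz_kernel_eq[OF \<open>Im ?z \<noteq> 0\<close>] norm_mult norm_of_real by simp
  qed
  ultimately show ?thesis by simp
qed

lemma kernel_measurable [measurable]: "kernel y \<in> borel_measurable \<mu>"
  by measurable

lemma integrable_weight: "integrable \<mu> (\<lambda>t. 1 / (1 + t\<^sup>2))"
  using weight by (simp add: has_bochner_integral_iff)

lemma integrable_kernel: "1 \<le> y \<Longrightarrow> integrable \<mu> (kernel y)"
  using norm_kernel_le[of y]
  by (intro Bochner_Integration.integrable_bound[OF integrable_mult_right[OF integrable_weight, of y]])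
    (auto simp: abs_mult)

lemma Im_imaginary_axis:
  assumes y: "1 \<le> y"
  shows "integrable \<mu> (\<lambda>t. y / (t\<^sup>2 + y\<^sup>2))"
    and "Im (V (\<i> * complex_of_real y)) = (LINT t|\<mu>. y / (t\<^sup>2 + y\<^sup>2))"
proof -
  have k: "Im (kernel y t) = y / (t\<^sup>2 + y\<^sup>2)" for t by (simp add: Im_divide)
  show "integrable \<mu> (\<lambda>t. y / (t\<^sup>2 + y\<^sup>2))"
    using integrable_Im[OF integrable_kernel[OF y]] unfolding k .
  show "Im (V (\<i> * complex_of_real y)) = (LINT t|\<mu>. y / (t\<^sup>2 + y\<^sup>2))"
    using integral_Im[OF integrable_kernel[OF y]] rep_imaginary_axis[of y] y unfolding k by simp
qed

text \<open>
  The function \<open>y Im V (i y) = \<integral> y\<^sup>2 / (t\<^sup>2 + y\<^sup>2) d\<mu>\<close> dominates half the mass of \<open>[- n, n]\<close> as soon as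
  \<open>y \<ge> n\<close>.
\<close>

lemma y_Im_unbounded:
  assumes inf: "emeasure \<mu> UNIV = \<infinity>"
  shows "\<exists>Y\<ge>1. \<forall>y\<ge>Y. B \<le> y * Im (V (\<i> * complex_of_real y))"
proof -
  let ?I = "\<lambda>n::nat. {- real n..real n}"
  have "(SUP n. emeasure \<mu> (?I n)) = emeasure \<mu> (\<Union>n. ?I n)"
    by (intro SUP_emeasure_incseq) (auto simp: incseq_def sets_\<mu>)
  also have "(\<Union>n. ?I n) = UNIV"
  proof (intro set_eqI iffI UNIV_I)
    fix x :: real
    obtain n :: nat where "\<bar>x\<bar> \<le> real n" using real_arch_simple by blast
    then show "x \<in> (\<Union>n. ?I n)" by (auto simp: abs_le_iff intro!: exI[of _ n])
  qed
  finally have "ennreal (2 * \<bar>B\<bar>) < (SUP n. emeasure \<mu> (?I n))"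
    using inf by (simp only: ennreal_less_top infinity_ennreal_def)
  then obtain n where n: "ennreal (2 * \<bar>B\<bar>) < emeasure \<mu> (?I n)" by (auto simp: less_SUP_iff)
  have fin: "emeasure \<mu> (?I n) < \<infinity>"
  proof -
    have "ennreal (1 / (1 + (real n)\<^sup>2)) * emeasure \<mu> (?I n)
        = (\<integral>\<^sup>+t. ennreal (1 / (1 + (real n)\<^sup>2)) * indicator (?I n) t \<partial>\<mu>)"
      by (subst nn_integral_cmult_indicator) (auto simp: sets_\<mu>)
    also have "\<dots> \<le> (\<integral>\<^sup>+t. ennreal (1 / (1 + t\<^sup>2)) \<partial>\<mu>)"
    proof (intro nn_integral_mono)
      fix t
      have "1 / (1 + (real n)\<^sup>2) \<le> 1 / (1 + t\<^sup>2)" if "t \<in> ?I n"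
        using that by (intro divide_left_mono add_left_mono abs_le_square_iff[THEN iffD1])
          (auto simp: abs_le_iff add_pos_nonneg)
      then show "ennreal (1 / (1 + (real n)\<^sup>2)) * indicator (?I n) t \<le> ennreal (1 / (1 + t\<^sup>2))"
        by (auto simp: indicator_def intro!: ennreal_leI)
    qed
    also have "\<dots> < \<infinity>" using integrable_weight by (simp add: integrable_iff_bounded)
    finally have "ennreal (1 / (1 + (real n)\<^sup>2)) * emeasure \<mu> (?I n) < \<infinity>" .
    moreover have "0 < 1 + (real n)\<^sup>2" by (simp add: add_pos_nonneg)
    ultimately show ?thesis by (auto simp: ennreal_mult_less_top)
  qed
  have mn: "2 * \<bar>B\<bar> < measure \<mu> (?I n)"
    using n fin by (simp add: emeasure_eq_ennreal_measure ennreal_less_iff)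
  show ?thesis
  proof (intro exI[of _ "max 1 (real n)"] conjI allI impI)
    fix y assume "max 1 (real n) \<le> y"
    then have y: "1 \<le> y" "real n \<le> y" by auto
    have "measure \<mu> (?I n) * (1 / 2) = (LINT t|\<mu>. indicator (?I n) t * (1/2))"
      by (simp add: sets_\<mu> sets_eq_imp_space_eq[OF sets_\<mu>])
    also have "\<dots> \<le> (LINT t|\<mu>. y * (y / (t\<^sup>2 + y\<^sup>2)))"
    proof (rule integral_mono)
      show "integrable \<mu> (\<lambda>t. indicator (?I n) t * (1/2 :: real))"
        using fin by (intro integrable_mult_left integrable_real_indicator) (auto simp: sets_\<mu>)
      show "integrable \<mu> (\<lambda>t. y * (y / (t\<^sup>2 + y\<^sup>2)))"
        by (intro integrable_mult_right Im_imaginary_axis y)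
      fix t
      show "indicator (?I n) t * (1/2) \<le> y * (y / (t\<^sup>2 + y\<^sup>2))"
      proof (cases "t \<in> ?I n")
        case True
        then have "t\<^sup>2 \<le> y\<^sup>2" using y by (intro abs_le_square_iff[THEN iffD1]) (auto simp: abs_le_iff)
        moreover have "0 < t\<^sup>2 + y\<^sup>2" using y by (simp add: add_nonneg_pos)
        ultimately show ?thesis using True by (simp add: field_simps power2_eq_square)
      qed (use y in simp)
    qed
    also have "\<dots> = y * Im (V (\<i> * complex_of_real y))"
      unfolding Im_imaginary_axis(2)[OF y(1)] by (rule integral_mult_right_zero)
    finally show "B \<le> y * Im (V (\<i> * complex_of_real y))" using mn by linarith
  qed simp
qed

text \<open>
  For \<open>y \<ge> 1\<close> the quotient of the kernel by \<open>y\<close> is dominated by the integrable weight \<open>1 / (1 + t\<^sup>2)\<close>,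
  and it tends to \<open>0\<close> for every \<open>t\<close>.
\<close>

lemma no_linear_growth: "((\<lambda>y. V (\<i> * complex_of_real y) / complex_of_real y) \<longlongrightarrow> 0) at_top"
proof -
  have "((\<lambda>y. LINT t|\<mu>. kernel y t / complex_of_real y) \<longlongrightarrow> (LINT t|\<mu>. 0)) at_top"
  proof (rule integral_dominated_convergence_at_top[OF _ _ integrable_weight])
    show "\<forall>\<^sub>F y in at_top. AE t in \<mu>. norm (kernel y t / complex_of_real y) \<le> 1 / (1 + t\<^sup>2)"
      using eventually_ge_at_top[of 1]
    proof eventually_elim
      case (elim y)
      have ny: "cmod (complex_of_real y) = y" using elim by simp
      have "cmod (kernel y t) / y \<le> 1 / (1 + t\<^sup>2)" for t
      proof (rule pos_divide_le_eq[THEN iffD2])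
        show "cmod (kernel y t) \<le> 1 / (1 + t\<^sup>2) * y"
          using norm_kernel_le[OF elim, of t] by (simp only: mult.commute)
        show "0 < y" using elim by simp
      qed
      then have "norm (kernel y t / complex_of_real y) \<le> 1 / (1 + t\<^sup>2)" for t
        by (simp only: norm_divide[of "kernel y t"] ny)
      then show ?case by (rule AE_I2)
    qed
    show "AE t in \<mu>. ((\<lambda>y. kernel y t / complex_of_real y) \<longlongrightarrow> 0) at_top"
    proof (rule AE_I2, rule Lim_null_comparison)
      fix t
      show "\<forall>\<^sub>F y in at_top. norm (kernel y t / complex_of_real y) \<le> (1 + \<bar>t / (1 + t\<^sup>2)\<bar>) * (1 / y)"
        using eventually_ge_at_top[of 1]
      proof eventually_elim
        case (elim y)
        have "1 \<le> cmod (complex_of_real t - \<i> * complex_of_real y)"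
          using abs_Im_le_cmod[of "complex_of_real t - \<i> * complex_of_real y"] elim by simp
        then have "cmod (1 / (complex_of_real t - \<i> * complex_of_real y)) \<le> 1"
          by (simp add: norm_divide divide_le_eq)
        moreover have "cmod (complex_of_real (t / (1 + t\<^sup>2))) = \<bar>t / (1 + t\<^sup>2)\<bar>" by (rule norm_of_real)
        ultimately have "cmod (kernel y t) \<le> 1 + \<bar>t / (1 + t\<^sup>2)\<bar>"
          by (intro norm_triangle_ineq4[THEN order_trans]) linarith
        then show ?case using elim by (simp add: norm_divide divide_right_mono)
      qed
      show "((\<lambda>y::real. (1 + \<bar>t / (1 + t\<^sup>2)\<bar>) * (1 / y)) \<longlongrightarrow> 0) at_top"
        by (intro tendsto_mult_right_zero) (simp add: tendsto_inverse_0_at_top filterlim_ident divide_inverse)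
    qed
  qed simp_all
  moreover have "((\<lambda>y. complex_of_real (q * (1 / y))) \<longlongrightarrow> complex_of_real 0) at_top"
    by (intro tendsto_of_real tendsto_mult_right_zero)
      (simp add: tendsto_inverse_0_at_top filterlim_ident divide_inverse)
  ultimately have "((\<lambda>y. complex_of_real (q * (1 / y)) + (LINT t|\<mu>. kernel y t / complex_of_real y)) \<longlongrightarrow> 0) at_top"
    by (auto dest: tendsto_add)
  moreover have "\<forall>\<^sub>F y in at_top. complex_of_real (q * (1 / y)) + (LINT t|\<mu>. kernel y t / complex_of_real y)
      = V (\<i> * complex_of_real y) / complex_of_real y"
    using eventually_ge_at_top[of 1]
    by eventually_elim (simp add: rep_imaginary_axis add_divide_distrib)
  ultimately show ?thesis by (rule Lim_transform_eventually)
qed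

text \<open>
  For a finite measure the two terms of the kernel are integrable separately. The integral of the
  second is real and independent of \<open>y\<close>, that of the first is at most the total mass divided by \<open>y\<close>.
\<close>

lemma limit_if_finite_measure:
  assumes fin: "emeasure \<mu> UNIV \<noteq> \<infinity>"
  obtains c M :: real where "0 \<le> M"
    and "\<forall>y\<ge>1. cmod (V (\<i> * complex_of_real y) - complex_of_real c) \<le> M / y"
proof -
  have sp: "space \<mu> = UNIV" using sets_eq_imp_space_eq[OF sets_\<mu>] by simp
  interpret finite_measure \<mu> by standard (use fin sp in simp)
  have [simp]: "0 < 1 + t\<^sup>2" for t :: real by (simp add: add_pos_nonneg)
  have "\<bar>t / (1 + t\<^sup>2)\<bar> \<le> 1" for t :: real
  proof -
    have "0 \<le> (\<bar>t\<bar> - 1)\<^sup>2" by simp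
    then have "2 * \<bar>t\<bar> \<le> 1 + t\<^sup>2" by (simp add: power2_eq_square algebra_simps)
    then show ?thesis using abs_ge_zero[of t] by (simp add: abs_divide)
  qed
  then have i1: "integrable \<mu> (\<lambda>t. complex_of_real (t / (1 + t\<^sup>2)))"
    by (intro integrable_of_real integrable_const_bound[where B = 1]) auto
  have b: "cmod (1 / (complex_of_real t - \<i> * complex_of_real y)) \<le> 1 / y" if "1 \<le> y" for y t
  proof -
    have "y \<le> cmod (complex_of_real t - \<i> * complex_of_real y)"
      using abs_Im_le_cmod[of "complex_of_real t - \<i> * complex_of_real y"] that by simp
    then show ?thesis using that by (simp add: norm_divide frac_le)
  qed
  define c where "c = q - (LINT t|\<mu>. t / (1 + t\<^sup>2))"
  have "cmod (V (\<i> * complex_of_real y) - complex_of_real c) \<le> measure \<mu> UNIV / y" if y: "1 \<le> y" for y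
  proof -
    have i2: "integrable \<mu> (\<lambda>t. 1 / (complex_of_real t - \<i> * complex_of_real y))"
      using b[OF y] by (intro integrable_const_bound[where B = "1 / y"]) auto
    have "(LINT t|\<mu>. kernel y t) = (LINT t|\<mu>. 1 / (complex_of_real t - \<i> * complex_of_real y))
        - complex_of_real (LINT t|\<mu>. t / (1 + t\<^sup>2))"
      unfolding Bochner_Integration.integral_diff[OF i2 i1] by (simp only: integral_complex_of_real)
    then have "V (\<i> * complex_of_real y) - complex_of_real c
        = (LINT t|\<mu>. 1 / (complex_of_real t - \<i> * complex_of_real y))"
      using rep_imaginary_axis[of y] y by (simp add: c_def)
    also have "cmod \<dots> \<le> (LINT t|\<mu>. cmod (1 / (complex_of_real t - \<i> * complex_of_real y)))"
      by (rule integral_norm_bound)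
    also have "\<dots> \<le> (LINT t|\<mu>. 1 / y)"
      using b[OF y] by (intro integral_mono integrable_norm i2 integrable_const)
    also have "\<dots> = measure \<mu> UNIV / y" by (simp add: sp)
    finally show ?thesis .
  qed
  then show thesis using that[of "measure \<mu> UNIV" c] by simp
qed

end

section \<open>Rotated impedance functions\<close>

lemma class_M_invE:
  assumes "V \<in> class_M_inv \<kappa> q"
  obtains \<mu> where "herglotz_integral \<mu> V q ((1 + \<kappa>) / (1 - \<kappa>))" and "emeasure \<mu> UNIV = \<infinity>"
proof -
  obtain \<mu> :: "real measure" where \<mu>: "sets \<mu> = sets borel" "emeasure \<mu> UNIV = \<infinity>"
      "has_bochner_integral \<mu> (\<lambda>t. 1 / (1 + t\<^sup>2)) ((1 + \<kappa>) / (1 - \<kappa>))"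
    and rep: "\<And>z. 0 < Im z \<Longrightarrow> V z = complex_of_real q +
      (LINT t|\<mu>. (1 / (complex_of_real t - z) - complex_of_real (t / (1 + t\<^sup>2))))"
    using assms unfolding class_M_inv_def by blast
  have "herglotz_integral \<mu> V q ((1 + \<kappa>) / (1 - \<kappa>))"
    by unfold_locales (use \<mu> rep in auto)
  then show thesis using that \<mu> by blast
qed

text \<open>
  Membership of \<open>U = (1 + \<tau> V) / (\<tau> - V)\<close> depends only on its value at \<open>i\<close>: the absence of a linear
  term and the infinity of the measure are inherited from \<open>V\<close>. The proof uses
  \<open>(U + \<tau>) (\<tau> - V) = 1 + \<tau>\<^sup>2\<close>. A linear term of \<open>U\<close> would force \<open>y Im V (i y)\<close> to stay bounded.
  If the measure of \<open>U\<close> were finite, then \<open>U (i y) = c + O(1/y)\<close>; for \<open>c = - \<tau>\<close> the function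
  \<open>V\<close> would grow linearly, and otherwise \<open>y Im V (i y)\<close> would again stay bounded.
\<close>

lemma class_M_inv_rotation:
  fixes V U :: "complex \<Rightarrow> complex" and \<tau> :: real
  assumes V: "V \<in> class_M_inv \<kappa> q"
    and rel: "\<And>z. 0 < Im z \<Longrightarrow> U z * (complex_of_real \<tau> - V z) = 1 + complex_of_real \<tau> * V z"
    and Ui: "U \<i> = Complex p ((1 + \<kappa>) / (1 - \<kappa>))"
  shows "U \<in> class_M_inv \<kappa> p"
proof -
  obtain \<mu> where hi: "herglotz_integral \<mu> V q ((1 + \<kappa>) / (1 - \<kappa>))" and inf: "emeasure \<mu> UNIV = \<infinity>"
    using class_M_invE[OF V] .
  interpret V: herglotz_integral \<mu> V q "(1 + \<kappa>) / (1 - \<kappa>)" by (rule hi)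
  have Vhol: "V holomorphic_on {z. 0 < Im z}" and Vpos: "\<And>z. 0 < Im z \<Longrightarrow> 0 < Im (V z)"
    using V by (auto simp: class_M_inv_def herglotz_nevanlinna_def image_subset_iff)
  have ne: "complex_of_real \<tau> - V z \<noteq> 0" if "0 < Im z" for z
    using Vpos[OF that] by (auto simp: complex_eq_iff)
  have Uq: "U z = (1 + complex_of_real \<tau> * V z) / (complex_of_real \<tau> - V z)" if "0 < Im z" for z
    using rel[OF that] ne[OF that] by (simp add: field_simps)
  have prod: "(U z + complex_of_real \<tau>) * (complex_of_real \<tau> - V z) = complex_of_real (1 + \<tau>\<^sup>2)"
    if "0 < Im z" for z
    using rel[OF that] by (simp add: algebra_simps power2_eq_square)
  have pos\<tau>: "0 < 1 + \<tau>\<^sup>2" by (simp add: add_pos_nonneg)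
  have Im_inverse: "Im w = r * Im (- v) / (cmod v)\<^sup>2" if "w * v = complex_of_real r" "v \<noteq> 0" for w v r
  proof -
    have "w = complex_of_real r * cnj v / complex_of_real ((cmod v)\<^sup>2)"
      using that unfolding complex_norm_square by (simp add: field_simps)
    then show ?thesis by (simp only: Im_divide_of_real) simp
  qed
  have ImU: "Im (U z) = (1 + \<tau>\<^sup>2) * Im (V z) / (cmod (complex_of_real \<tau> - V z))\<^sup>2" if "0 < Im z" for z
    using Im_inverse[OF prod[OF that] ne[OF that]] by simp
  have Upos: "0 < Im (U z)" if "0 < Im z" for z
    unfolding ImU[OF that] using Vpos[OF that] ne[OF that] pos\<tau> by simp
  have "U holomorphic_on {z. 0 < Im z} \<longleftrightarrow>
      (\<lambda>z. (1 + complex_of_real \<tau> * V z) / (complex_of_real \<tau> - V z)) holomorphic_on {z. 0 < Im z}"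
    using Uq by (intro holomorphic_cong) auto
  also have "\<dots>" using ne by (intro holomorphic_intros Vhol) auto
  finally have Uh: "herglotz_nevanlinna U"
    unfolding herglotz_nevanlinna_def using Upos by auto
  have sub: "\<exists>y>0. Im (U (\<i> * complex_of_real y)) < \<epsilon> * y" if \<epsilon>: "0 < \<epsilon>" for \<epsilon> :: real
  proof -
    \<comment> \<open>By \<open>Im U \<le> (1 + \<tau>\<^sup>2) / Im V\<close> any bound \<open>B > (1 + \<tau>\<^sup>2) / \<epsilon>\<close> for \<open>y Im V (i y)\<close> will do.\<close>
    define B where "B = (1 + \<tau>\<^sup>2) / \<epsilon> + 1"
    have B: "0 < B" "1 + \<tau>\<^sup>2 < \<epsilon> * B" using \<epsilon> pos\<tau> by (simp_all add: B_def field_simps add_pos_pos)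
    obtain y where y: "1 \<le> y" and yB: "B \<le> y * Im (V (\<i> * complex_of_real y))"
      using V.y_Im_unbounded[OF inf, of B] by blast
    let ?v = "V (\<i> * complex_of_real y)"
    have z: "0 < Im (\<i> * complex_of_real y)" using y by simp
    note v = Vpos[OF z]
    have "(Im ?v)\<^sup>2 \<le> (cmod (complex_of_real \<tau> - ?v))\<^sup>2" by (simp add: cmod_power2)
    then have "Im (U (\<i> * complex_of_real y)) \<le> (1 + \<tau>\<^sup>2) * Im ?v / (Im ?v)\<^sup>2"
      unfolding ImU[OF z] using v pos\<tau> by (intro divide_left_mono mult_pos_pos) auto
    also have "\<dots> = (1 + \<tau>\<^sup>2) / Im ?v" using v by (simp add: power2_eq_square)
    also have "\<dots> < \<epsilon> * y"
    proof -
      have "1 + \<tau>\<^sup>2 < \<epsilon> * (y * Im ?v)" using B(2) mult_left_mono[OF yB, of \<epsilon>] \<epsilon> by linarith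
      then show ?thesis using v by (simp add: divide_less_eq mult_ac)
    qed
    finally show ?thesis using y by (intro exI[of _ y]) auto
  qed
  obtain \<mu>' :: "real measure" where \<mu>': "sets \<mu>' = sets borel"
      "has_bochner_integral \<mu>' (\<lambda>t. 1 / (1 + t\<^sup>2)) (Im (U \<i>))"
    and rep': "\<forall>z. 0 < Im z \<longrightarrow> U z = complex_of_real (Re (U \<i>)) +
      (LINT t|\<mu>'. (1 / (complex_of_real t - z) - complex_of_real (t / (1 + t\<^sup>2))))"
  proof (rule herglotz_representation_without_linear_term[OF Uh])
    show "\<exists>y>0. Im (U (\<i> * complex_of_real y)) < \<epsilon> * y" if "0 < \<epsilon>" for \<epsilon> by (rule sub[OF that])
  qed (rule that)
  have U: "herglotz_integral \<mu>' U (Re (U \<i>)) (Im (U \<i>))"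
  proof (rule herglotz_integral.intro)
    show "U z = complex_of_real (Re (U \<i>)) +
        (LINT t|\<mu>'. (1 / (complex_of_real t - z) - complex_of_real (t / (1 + t\<^sup>2))))"
      if "0 < Im z" for z
      by (rule rep'[THEN spec, THEN mp, OF that])
  qed (rule \<mu>')+
  have "emeasure \<mu>' UNIV = \<infinity>"
  proof (rule ccontr)
    assume "emeasure \<mu>' UNIV \<noteq> \<infinity>"
    then obtain c M where M: "0 \<le> M"
      and "\<forall>y\<ge>1. cmod (U (\<i> * complex_of_real y) - complex_of_real c) \<le> M / y"
      by (rule herglotz_integral.limit_if_finite_measure[OF U])
    then have lim: "cmod (U (\<i> * complex_of_real y) - complex_of_real c) \<le> M / y" if "1 \<le> y" for y
      using that by blast
    show False
    proof (cases "c = - \<tau>")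
      case True
      have "((\<lambda>y. M * cmod (complex_of_real (\<tau> * (1 / y)) - V (\<i> * complex_of_real y) / complex_of_real y))
          \<longlongrightarrow> M * cmod (complex_of_real (\<tau> * 0) - 0)) at_top"
        by (intro tendsto_intros V.no_linear_growth)
          (simp add: tendsto_inverse_0_at_top filterlim_ident divide_inverse)
      then have "\<forall>\<^sub>F y in at_top. M * cmod (complex_of_real (\<tau> * (1 / y))
          - V (\<i> * complex_of_real y) / complex_of_real y) < 1"
        by (intro order_tendstoD(2)) auto
      then have "\<forall>\<^sub>F y::real in at_top. False"
        using eventually_ge_at_top[of 1]
      proof eventually_elim
        case (elim y)
        let ?z = "\<i> * complex_of_real y"
        have "1 + \<tau>\<^sup>2 = cmod (U ?z + complex_of_real \<tau>) * cmod (complex_of_real \<tau> - V ?z)"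
          using arg_cong[OF prod[of ?z], of cmod] elim pos\<tau> by (simp only: norm_mult norm_of_real) simp
        also have "\<dots> \<le> (M / y) * cmod (complex_of_real \<tau> - V ?z)"
          using lim[of y] elim True by (intro mult_right_mono) auto
        also have "\<dots> = M * cmod ((complex_of_real \<tau> - V ?z) / complex_of_real y)"
          using elim by (simp add: norm_divide)
        also have "\<dots> < 1" using elim by (simp add: diff_divide_distrib)
        finally show False by (simp add: not_less[symmetric])
      qed
      then show False by simp
    next
      case False
      define d where "d = \<bar>c + \<tau>\<bar>"
      have d: "0 < d" using False by (simp add: d_def)
      \<comment> \<open>For large \<open>y\<close> we have \<open>|U + \<tau>| \<ge> d / 2\<close> and \<open>Im U \<le> M / y\<close>, so \<open>y Im V (i y) \<le> B - 1\<close>.\<close>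
      define B where "B = 4 * (1 + \<tau>\<^sup>2) * M / d\<^sup>2 + 1"
      obtain Y where Y: "1 \<le> Y" and big: "\<And>y. Y \<le> y \<Longrightarrow> B \<le> y * Im (V (\<i> * complex_of_real y))"
        using V.y_Im_unbounded[OF inf, of B] by blast
      define y where "y = max Y (2 * M / d)"
      have y: "1 \<le> y" "Y \<le> y" "2 * M / d \<le> y" using Y by (auto simp: y_def)
      let ?z = "\<i> * complex_of_real y"
      have z: "0 < Im ?z" using y by simp
      have "M / y \<le> d / 2" using y d by (simp add: field_simps)
      moreover have "d \<le> cmod (U ?z + complex_of_real \<tau>) + cmod (U ?z - complex_of_real c)"
      proof -
        have "d = cmod (complex_of_real (c + \<tau>))" by (simp only: norm_of_real d_def)
        also have "complex_of_real (c + \<tau>) = (U ?z + complex_of_real \<tau>) - (U ?z - complex_of_real c)" by simp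
        finally show ?thesis using norm_triangle_ineq4 by metis
      qed
      ultimately have low: "d / 2 \<le> cmod (U ?z + complex_of_real \<tau>)" using lim[OF y(1)] by linarith
      then have une: "U ?z + complex_of_real \<tau> \<noteq> 0" using d by auto
      have "Im (U ?z) \<le> M / y"
        using lim[OF y(1)] abs_Im_le_cmod[of "U ?z - complex_of_real c"] by simp
      have "(complex_of_real \<tau> - V ?z) * (U ?z + complex_of_real \<tau>) = complex_of_real (1 + \<tau>\<^sup>2)"
        using prod[OF z] by (simp only: mult.commute)
      from Im_inverse[OF this une]
      have "Im (V ?z) = (1 + \<tau>\<^sup>2) * Im (U ?z) / (cmod (U ?z + complex_of_real \<tau>))\<^sup>2" by simp
      also have "\<dots> \<le> (1 + \<tau>\<^sup>2) * (M / y) / (d / 2)\<^sup>2"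
        using low d y(1) M pos\<tau> \<open>Im (U ?z) \<le> M / y\<close>
        by (intro frac_le mult_left_mono power_mono mult_nonneg_nonneg divide_nonneg_nonneg) auto
      finally have "y * Im (V ?z) \<le> y * ((1 + \<tau>\<^sup>2) * (M / y) / (d / 2)\<^sup>2)"
        using y by (intro mult_left_mono) auto
      also have "\<dots> = B - 1" using y d by (simp add: B_def power_divide)
      finally show False using big[OF y(2)] by simp
    qed
  qed
  then show ?thesis
    using Uh \<mu>' rep' unfolding class_M_inv_def Ui complex.sel by blast
qed

theorem theorem11:
  fixes \<kappa> Q \<alpha> a b :: real
    and \<Theta> :: "'a::complex_hilbert lsys"
    and \<Theta>\<^sub>\<alpha> :: "'b::complex_hilbert lsys"
  assumes "0 \<le> \<kappa>" and "\<kappa> < 1" and "Q \<noteq> 0"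
    and "minimal_L_system \<Theta>"
    and "impedance_function \<Theta> \<in> class_M_inv \<kappa> Q"
    and "unimodular_transformation \<alpha> \<Theta>\<^sub>\<alpha> \<Theta>" and "\<alpha> \<noteq> pi / 2"
    and "a = (1 + \<kappa>) / (1 - \<kappa>)" and "b = Q\<^sup>2 + a\<^sup>2 - 1"
  shows "impedance_function \<Theta>\<^sub>\<alpha> \<in> class_M_inv \<kappa> (- Q) \<longleftrightarrow> tan \<alpha> = b / (2 * Q)"
proof -
  define V U \<tau> where "V = impedance_function \<Theta>" and "U = impedance_function \<Theta>\<^sub>\<alpha>" and "\<tau> = tan \<alpha>"
  have a: "0 < a" using assms(1,2,8) by simp
  have "cos \<alpha> \<noteq> cos (pi / 2)"
    using cos_inj_pi[of \<alpha> "pi / 2"] assms(6,7) by (auto simp: unimodular_transformation_def)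
  then have cos: "cos \<alpha> \<noteq> 0" by simp
  have rel: "U z * (complex_of_real \<tau> - V z) = 1 + complex_of_real \<tau> * V z" if "0 < Im z" for z
    unfolding U_def V_def \<tau>_def
    by (rule impedance_of_unimodular_transformation[OF assms(6) cos that])
  have value_at_i: "F \<i> = Complex q a" if F: "F \<in> class_M_inv \<kappa> q" for F q
  proof -
    obtain \<mu> where "herglotz_integral \<mu> F q ((1 + \<kappa>) / (1 - \<kappa>))" using class_M_invE[OF F] by blast
    from herglotz_integral.value_at_i[OF this] show ?thesis using assms(8) by simp
  qed
  have Vi: "V \<i> = Complex Q a" using value_at_i assms(5) by (simp add: V_def)
  \<comment> \<open>The imaginary parts agree for every \<open>\<tau>\<close>; the real parts give \<open>2 \<tau> Q = Q\<^sup>2 + a\<^sup>2 - 1\<close>.\<close>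
  have iff: "Complex (- Q) a * (complex_of_real \<tau> - V \<i>) = 1 + complex_of_real \<tau> * V \<i>
      \<longleftrightarrow> \<tau> = b / (2 * Q)"
    using assms(3) unfolding Vi assms(9)
    by (auto simp: complex_eq_iff field_simps power2_eq_square)
  have ne: "complex_of_real \<tau> - V \<i> \<noteq> 0" using a by (simp add: Vi complex_eq_iff)
  have "U \<in> class_M_inv \<kappa> (- Q) \<longleftrightarrow> U \<i> = Complex (- Q) a"
    using value_at_i class_M_inv_rotation[OF assms(5)[folded V_def] rel] assms(8) by metis
  also have "\<dots> \<longleftrightarrow> U \<i> * (complex_of_real \<tau> - V \<i>) = Complex (- Q) a * (complex_of_real \<tau> - V \<i>)"
    using ne by simp
  also have "\<dots> \<longleftrightarrow> \<tau> = b / (2 * Q)"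
    using rel[of \<i>] iff by auto
  finally show ?thesis by (simp only: U_def \<tau>_def)
qed

end
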